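(* Fix $p\in(0,1)$. For (Lebesgue-)almost all $\beta_0,\beta_1\in(0,0.739)$ with \[ \beta_0\,\beta_1^{1-p}>p^{p}(1-p)^{1-p}, \] the nonuniform Markov geometric measure $\mu_{\beta_0,\beta_1,p}$ is absolutely continuous with respect to Lebesgue measure on $\mathbb{R}$. Moreover, for (Lebesgue-)almost all $\beta_0,\beta_1\in(0,0.739)$ with \[ (\beta_0-p^2)\,\beta_1>(1-p)^2, \] the measure $\mu_{\beta_0,\beta_1,p}$ has a density in $L^2$.
   Context: For $p\in(0,1)$ let $(X_i)_{i\ge 1}$ be the Markov chain with states $0,1$, transition probabilities $p_{ab}=\mathrm{Prob}(X_{i+1}=b\mid X_i=a)$ given by $p_{00}=p$, $p_{01}=1-p$, $p_{10}=1$, $p_{11}=0$, and initial distribution $\mathrm{Prob}(X_1=0)=\frac{1}{2-p}$, $\mathrm{Prob}(X_1=1)=\frac{1-p}{2-p}$. Put $\hat X_i=\sum_{k=1}^{i}X_k$. For $\beta_0,\beta_1\in(0,1)$ let \[ S=\sum_{i=1}^{\infty}X_i\,\beta_1^{\hat X_i}\beta_0^{\,i-\hat X_i}. \] The nonuniform Markov geometric measure $\mu_{\beta_0,\beta_1,p}$ is the distribution of $S$, i.e. $\mu_{\beta_0,\beta_1,p}(B)=\mathrm{Prob}(S\in B)$ for Borel sets $B\subseteq\mathbb{R}$. "Almost all $\beta_0,\beta_1$" refers to two-dimensional Lebesgue measure on pairs $(\beta_0,\beta_1)$. A measure has density in $L^2$ if it is absolutely continuous with respect to Lebesgue measure and its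 Radon–Nikodym density $f$ satisfies $\int f^2<\infty$ (integral with respect to Lebesgue measure). *)

theory Defs
  imports "HOL-Probability.Probability"
begin

definition trans_prob :: "real \<Rightarrow> nat \<Rightarrow> nat \<Rightarrow> real" where
  "trans_prob p a b =
     (if a = 0 then (if b = 0 then p else 1 - p)
      else (if b = 0 then 1 else 0))"

definition init_prob :: "real \<Rightarrow> nat \<Rightarrow> real" where
  "init_prob p a = (if a = 0 then 1 / (2 - p) else (1 - p) / (2 - p))"

text \<open>The chain is indexed from 1; \<^term>\<open>X 0\<close> is left unconstrained and is never used.\<close>

definition markov_chain01 :: "real \<Rightarrow> 'a measure \<Rightarrow> (nat \<Rightarrow> 'a \<Rightarrow> nat) \<Rightarrow> bool" where
  "markov_chain01 p M X \<longleftrightarrow>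
     prob_space M \<and>
     (\<forall>i\<ge>1. X i \<in> measurable M (count_space {0, 1})) \<and>
     (\<forall>a\<in>{0, 1}. \<P>(\<omega> in M. X 1 \<omega> = a) = init_prob p a) \<and>
     (\<forall>n\<ge>1. \<forall>x\<in>{1..n} \<rightarrow> {0, 1}. \<forall>b\<in>{0, 1}.
        \<P>(\<omega> in M. \<forall>i\<in>{1..n}. X i \<omega> = x i) > 0 \<longrightarrow>
        \<P>(\<omega> in M. X (Suc n) \<omega> = b \<bar> \<forall>i\<in>{1..n}. X i \<omega> = x i) = trans_prob p (x n) b)"

definition partial_count :: "(nat \<Rightarrow> 'a \<Rightarrow> nat) \<Rightarrow> nat \<Rightarrow> 'a \<Rightarrow> nat" where
  "partial_count X i \<omega> = (\<Sum>k = 1..i. X k \<omega>)"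

text \<open>The series over \<open>i \<ge> 1\<close> is shifted to start at 0. The natural-number
  subtraction does not truncate, since the \<open>X\<close> take values in \<open>{0, 1}\<close>.\<close>

definition geometric_sum :: "real \<Rightarrow> real \<Rightarrow> (nat \<Rightarrow> 'a \<Rightarrow> nat) \<Rightarrow> 'a \<Rightarrow> real" where
  "geometric_sum \<beta>0 \<beta>1 X \<omega> =
     (\<Sum>j. let i = Suc j in
        real (X i \<omega>) * \<beta>1 ^ partial_count X i \<omega> * \<beta>0 ^ (i - partial_count X i \<omega>))"

definition markov_geometric_measure ::
    "real \<Rightarrow> real \<Rightarrow> 'a measure \<Rightarrow> (nat \<Rightarrow> 'a \<Rightarrow> nat) \<Rightarrow> real measure" where
  "markov_geometric_measure \<beta>0 \<beta>1 M X = distr M borel (geometric_sum \<beta>0 \<beta>1 X)"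

definition has_L2_density :: "real measure \<Rightarrow> bool" where
  "has_L2_density \<mu> \<longleftrightarrow>
     absolutely_continuous lborel \<mu> \<and> (\<integral>\<^sup>+ x. (RN_deriv lborel \<mu> x)\<^sup>2 \<partial>lborel) < \<infinity>"

end

theory Submission
  imports Defs
begin

text \<open>The proof is the transversality and energy method for families of overlapping random series, with
explicit estimates.

Two state sequences whose longest common prefix has length \<open>n\<close> have sums that differ by the contraction ratio of
the prefix times the difference for two sequences that start with different states. On a ray
\<open>(\<beta>0, \<beta>1) = (t a, t b)\<close> with \<open>max a b = 1\<close> the latter is \<open>b t f(t)\<close> up to sign, where \<open>f\<close> is a power
series. Because the chain never shows two consecutive ones, \<open>(1 + t) f(t) = 1 + e t + d\<^sub>2 t\<^sup>2 + d\<^sub>3 t\<^sup>3 + \<dots>\<close>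
with \<open>e \<ge> 0\<close> and all coefficients in \<open>[-1, 1]\<close>. Division by \<open>t\<^sup>6\<close> makes this series strictly
decreasing on \<open>(0, 0.739)\<close>, with a slope bounded away from zero (lemma \<open>transversality\<close>). Hence, in a box
of parameters, those for which the two sums are within \<open>r\<close> of each other have area \<open>O(r)\<close>
(lemma \<open>box_measure\<close>).

By Fubini and Fatou, for almost every parameter in the box above \<open>(c0, c1)\<close> the image measure \<open>\<nu>\<close> satisfies
\<open>(\<nu> \<times> \<nu>) {|x - y| < 2r} = O(r)\<close> along a sequence \<open>r \<rightarrow> 0\<close>, provided that the expectations of
\<open>W n = (probability of the n-th cylinder) / (its ratio at (c0, c1))\<close> are summable
(lemma \<open>AE_bounded_energy\<close>). Such a \<open>\<nu>\<close> is absolutely continuous with square integrable density; this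
follows by testing against open sets and continuous functions, without differentiation of measures.

The expectation of \<open>W n\<close> to the power \<open>s\<close> decays geometrically as soon as
\<open>p (p / c0)\<^sup>s + (1 - p) ((1 - p) / (c0 c1))\<^sup>s < 1\<close> (lemma \<open>summable_moments\<close>). For \<open>s = 1\<close> this is the
condition of the second part. The condition of the first part says that the derivative of the left-hand
side at \<open>s = 0\<close>, where its value is 1, is negative; so the inequality holds for some small \<open>s > 0\<close>.
Then \<open>W n\<close> is almost surely bounded in \<open>n\<close>, and on the event that it is bounded by \<open>K\<close> the expectations
of \<open>W n\<close> are summable too. This yields absolute continuity of the image of the measure restricted to that
event, and \<open>K \<rightarrow> \<infinity>\<close> gives the claim.\<close>

section \<open>Coding sums of binary sequences\<close>

text \<open>A state sequence is a function from naturals to truth values, \<open>True\<close> standing for the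
state 1, and is indexed from 0. \<open>wt b0 b1 x n\<close> is the contraction ratio of the first
\<open>n\<close> states: \<open>b1\<close> to the number of ones times \<open>b0\<close> to the number of zeros.\<close>
definition wt :: "real \<Rightarrow> real \<Rightarrow> (nat \<Rightarrow> bool) \<Rightarrow> nat \<Rightarrow> real" where
  "wt b0 b1 x n = (\<Prod>k<n. if x k then b1 else b0)"

text \<open>The value of the random series on the state sequence \<open>x\<close>.\<close>
definition code_sum :: "real \<Rightarrow> real \<Rightarrow> (nat \<Rightarrow> bool) \<Rightarrow> real" where
  "code_sum b0 b1 x = (\<Sum>i. of_bool (x i) * wt b0 b1 x (Suc i))"

text \<open>No two consecutive ones: the sequences that the chain can produce, since \<open>p\<^sub>1\<^sub>1 = 0\<close>.\<close>
definition isolated_ones :: "(nat \<Rightarrow> bool) \<Rightarrow> bool" where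
  "isolated_ones x \<longleftrightarrow> (\<forall>i. \<not> (x i \<and> x (Suc i)))"

lemma wt_0 [simp]: "wt b0 b1 x 0 = 1"
  by (simp add: wt_def)

lemma wt_Suc: "wt b0 b1 x (Suc n) = wt b0 b1 x n * (if x n then b1 else b0)"
  by (simp add: wt_def)

lemma wt_pos: "0 < b0 \<Longrightarrow> 0 < b1 \<Longrightarrow> 0 < wt b0 b1 x n"
  by (auto simp: wt_def intro!: prod_pos)

lemma wt_mono:
  "0 \<le> a0 \<Longrightarrow> 0 \<le> a1 \<Longrightarrow> a0 \<le> b0 \<Longrightarrow> a1 \<le> b1 \<Longrightarrow> wt a0 a1 x n \<le> wt b0 b1 x n"
  unfolding wt_def by (intro prod_mono) auto

lemma wt_const [simp]: "wt b b x n = b ^ n"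
  by (simp add: wt_def)

lemma wt_scale: "wt (t * a) (t * b) x n = t ^ n * wt a b x n"
  by (induction n) (auto simp: wt_Suc)

lemma wt_shift: "wt b0 b1 x (i + n) = wt b0 b1 x n * wt b0 b1 (\<lambda>k. x (k + n)) i"
  by (induction i) (auto simp: wt_Suc)

lemma wt_cong: "(\<And>k. k < n \<Longrightarrow> x k = y k) \<Longrightarrow> wt b0 b1 x n = wt b0 b1 y n"
  unfolding wt_def by (intro prod.cong) auto

lemma wt_le_1: "0 \<le> a \<Longrightarrow> a \<le> 1 \<Longrightarrow> 0 \<le> b \<Longrightarrow> b \<le> 1 \<Longrightarrow> 0 \<le> wt a b x n \<and> wt a b x n \<le> 1"
  unfolding wt_def by (auto intro!: prod_nonneg prod_le_1)

lemma summable_code: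
  assumes "0 \<le> b0" "b0 < 1" "0 \<le> b1" "b1 < 1"
  shows "summable (\<lambda>i. of_bool (x i) * wt b0 b1 x i :: real)"
proof (rule summable_comparison_test')
  let ?q = "max b0 b1"
  show "summable (\<lambda>i. ?q ^ i)"
    using assms by (intro summable_geometric) auto
  fix i :: nat
  have "0 \<le> wt b0 b1 x i" "wt b0 b1 x i \<le> ?q ^ i"
    using assms wt_le_1[of b0 b1 x i] wt_mono[of b0 b1 ?q ?q x i] by (auto simp: max.coboundedI1)
  then show "norm (of_bool (x i) * wt b0 b1 x i) \<le> ?q ^ i"
    using assms by auto
qed

text \<open>A term is nonzero only if its last state is 1, so a factor \<open>b1\<close> can be taken out.\<close>
lemma code_sum_alt:
  assumes "0 \<le> b0" "b0 < 1" "0 \<le> b1" "b1 < 1"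
  shows "code_sum b0 b1 x = b1 * (\<Sum>i. of_bool (x i) * wt b0 b1 x i)"
proof -
  have "code_sum b0 b1 x = (\<Sum>i. b1 * (of_bool (x i) * wt b0 b1 x i))"
    unfolding code_sum_def by (intro suminf_cong) (auto simp: wt_Suc)
  then show ?thesis
    using summable_code[OF assms, of x] by (simp add: suminf_mult)
qed

lemma summable_code':
  assumes "0 \<le> b0" "b0 < 1" "0 \<le> b1" "b1 < 1"
  shows "summable (\<lambda>i. of_bool (x i) * wt b0 b1 x (Suc i) :: real)"
proof -
  have "summable (\<lambda>i. b1 * (of_bool (x i) * wt b0 b1 x i))"
    by (intro summable_mult summable_code assms)
  also have "(\<lambda>i. b1 * (of_bool (x i) * wt b0 b1 x i)) = (\<lambda>i. of_bool (x i) * wt b0 b1 x (Suc i))"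
    by (auto simp: wt_Suc)
  finally show ?thesis .
qed

lemma code_sum_diff_prefix:
  assumes "0 \<le> b0" "b0 < 1" "0 \<le> b1" "b1 < 1"
    and agree: "\<And>k. k < n \<Longrightarrow> x k = y k"
  shows "code_sum b0 b1 x - code_sum b0 b1 y =
    wt b0 b1 x n * (code_sum b0 b1 (\<lambda>k. x (k + n)) - code_sum b0 b1 (\<lambda>k. y (k + n)))"
proof -
  have split: "code_sum b0 b1 z = wt b0 b1 z n * code_sum b0 b1 (\<lambda>k. z (k + n))
      + (\<Sum>i<n. of_bool (z i) * wt b0 b1 z (Suc i))" for z
  proof -
    have "code_sum b0 b1 z = (\<Sum>i. of_bool (z (i + n)) * wt b0 b1 z (Suc (i + n)))
        + (\<Sum>i<n. of_bool (z i) * wt b0 b1 z (Suc i))"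
      unfolding code_sum_def
      by (rule suminf_split_initial_segment[OF summable_code'[OF assms(1-4)]])
    also have "(\<Sum>i. of_bool (z (i + n)) * wt b0 b1 z (Suc (i + n)))
        = (\<Sum>i. wt b0 b1 z n * (of_bool (z (i + n)) * wt b0 b1 (\<lambda>k. z (k + n)) (Suc i)))"
      using wt_shift[of b0 b1 z "Suc _" n] by (intro suminf_cong) (auto simp: ac_simps)
    also have "\<dots> = wt b0 b1 z n * code_sum b0 b1 (\<lambda>k. z (k + n))"
      unfolding code_sum_def
      using summable_code'[OF assms(1-4), of "\<lambda>k. z (k + n)"] by (simp add: suminf_mult)
    finally show ?thesis .
  qed
  have "wt b0 b1 x m = wt b0 b1 y m" if "m \<le> n" for m
    using that agree by (intro wt_cong) auto
  moreover from this have "(\<Sum>i<n. of_bool (x i) * wt b0 b1 x (Suc i))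
      = (\<Sum>i<n. of_bool (y i) * wt b0 b1 y (Suc i))"
    using agree by (intro sum.cong) auto
  ultimately show ?thesis
    unfolding split[of x] split[of y] by (simp add: algebra_simps)
qed

section \<open>Transversality along rays\<close>

text \<open>This is where 0.739 comes from: \<open>t\<^sup>7 \<psi>'(t) = -6 + 4t\<^sup>2 + 3t\<^sup>3 + 2t\<^sup>4 + t\<^sup>5 + t\<^sup>7/(1-t)\<^sup>2\<close>
increases in \<open>t\<close> and is about -0.0209 at \<open>t = 0.739\<close>.\<close>
lemma comparison_function_decreasing:
  fixes t1 t2 :: real
  defines "\<psi> \<equiv> \<lambda>t::real. 1 / t^6 - 1 / t^4 - 1 / t^3 - 1 / t^2 - 1 / t + t / (1 - t)"
  assumes "0 < t1" "t1 \<le> t2" "t2 \<le> 0.739"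
  shows "\<psi> t1 - \<psi> t2 \<ge> 0.02 * (t2 - t1)"
proof -
  define d where "d t = -6 / t^7 + 4 / t^5 + 3 / t^4 + 2 / t^3 + 1 / t^2 + 1 / (1 - t)^2" for t :: real
  have deriv: "(\<psi> has_real_derivative d t) (at t)" if "0 < t" "t \<le> 0.739" for t
    unfolding \<psi>_def d_def using that
    by (auto intro!: derivative_eq_intros simp: field_simps power2_eq_square eval_nat_numeral)
  have bound: "d t \<le> - 0.02" if t: "0 < t" "t \<le> 0.739" for t
  proof -
    let ?u = "0.739 :: real"
    have pw: "t ^ n \<le> ?u ^ n" for n using t by (intro power_mono) auto
    have "t ^ 7 / (1 - t)^2 \<le> ?u ^ 7 / (1 - ?u)^2"
      using t by (intro frac_le power_mono) auto
    moreover have "t ^ 7 * d t = -6 + 4 * t^2 + 3 * t^3 + 2 * t^4 + t^5 + t^7 / (1 - t)^2"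
    proof -
      have "t ^ 7 / t ^ k = t ^ (7 - k)" if "k \<le> 7" for k
        using t that by (simp add: power_diff)
      moreover have "t ^ 7 * d t = -6 * (t ^ 7 / t ^ 7) + 4 * (t ^ 7 / t ^ 5) + 3 * (t ^ 7 / t ^ 4)
          + 2 * (t ^ 7 / t ^ 3) + t ^ 7 / t ^ 2 + t ^ 7 / (1 - t)^2"
        unfolding d_def by (simp add: algebra_simps)
      ultimately show ?thesis using t by simp
    qed
    ultimately have "t ^ 7 * d t \<le> -6 + 4 * ?u^2 + 3 * ?u^3 + 2 * ?u^4 + ?u^5 + ?u^7 / (1 - ?u)^2"
      using pw[of 2] pw[of 3] pw[of 4] pw[of 5] by linarith
    also have "\<dots> \<le> - 0.02" by (simp add: power_divide)
    finally have "t ^ 7 * d t \<le> - 0.02" .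
    moreover have "t ^ 7 \<le> 1" using t by (intro power_le_one) auto
    ultimately have "t ^ 7 * d t \<le> t ^ 7 * (- 0.02)" by simp
    then show ?thesis by (rule mult_left_le_imp_le) (use t in simp)
  qed
  show ?thesis
  proof (cases "t1 = t2")
    case False
    then have "t1 < t2" using assms by simp
    then obtain z where z: "t1 < z" "z < t2" "\<psi> t2 - \<psi> t1 = (t2 - t1) * d z"
      using MVT2[of t1 t2 \<psi> d] deriv assms by force
    have "(t2 - t1) * d z \<le> (t2 - t1) * (- 0.02)"
      using bound[of z] z assms by (intro mult_left_mono) auto
    with z show ?thesis by (simp add: algebra_simps)
  qed simp
qed

text \<open>Divided by \<open>t\<^sup>6\<close>, each monomial of degree other than 6 is monotone in \<open>t\<close>, so the difference of
two values is smallest, over all admissible coefficients, for the coefficients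
\<open>1, 0, -1, -1, -1, -1, *, 1, 1, \<dots>\<close> of \<open>\<psi>\<close>; the coefficient \<open>*\<close> of \<open>t\<^sup>6\<close> cancels. Unlike the usual
transversality condition, this needs no assumption that the series is near zero.\<close>
lemma transversality:
  fixes d :: "nat \<Rightarrow> real"
  assumes d0: "d 0 = 1" and d1: "0 \<le> d 1" and d: "\<And>i. \<bar>d i\<bar> \<le> 1"
    and t: "0 < t1" "t1 \<le> t2" "t2 \<le> 0.739"
  shows "(\<Sum>i. d i * t1 ^ i) / t1 ^ 6 - (\<Sum>i. d i * t2 ^ i) / t2 ^ 6 \<ge> 0.02 * (t2 - t1)"
proof -
  have summ: "summable (\<lambda>i. d i * t ^ i)" if "0 < t" "t \<le> 0.739" for t
    using that d by (intro summable_comparison_test'[OF summable_geometric[of t]])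
      (auto simp: abs_mult mult_left_le_one_le)
  have split: "(\<Sum>i. d i * t ^ i) / t ^ 6 = 1 / t^6 + d 1 / t^5 + d 2 / t^4 + d 3 / t^3
      + d 4 / t^2 + d 5 / t + d 6 + (\<Sum>i. d (i + 7) * t ^ Suc i)"
    and summ': "summable (\<lambda>i. d (i + 7) * t ^ Suc i)" if t: "0 < t" "t \<le> 0.739" for t
  proof -
    have "summable (\<lambda>i. d (i + 7) * t ^ (i + 7))"
      using summ[OF t] by (subst summable_iff_shift)
    then have s7: "summable (\<lambda>i. (d (i + 7) * t ^ (i + 7)) * (1 / t ^ 6))"
      by (rule summable_mult2)
    have eq: "(d (i + 7) * t ^ (i + 7)) * (1 / t ^ 6) = d (i + 7) * t ^ Suc i" for i
      using t by (simp add: power_add field_simps eval_nat_numeral)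
    show "summable (\<lambda>i. d (i + 7) * t ^ Suc i)" using s7 by (simp only: eq)
    have "(\<Sum>i. d i * t ^ i) = (\<Sum>i. d (i + 7) * t ^ (i + 7)) + (\<Sum>i<7. d i * t ^ i)"
      by (rule suminf_split_initial_segment[OF summ[OF t]])
    moreover have "(\<Sum>i. d (i + 7) * t ^ (i + 7)) / t ^ 6 = (\<Sum>i. d (i + 7) * t ^ Suc i)"
      using suminf_mult2[OF \<open>summable (\<lambda>i. d (i + 7) * t ^ (i + 7))\<close>, of "1 / t ^ 6"]
      by (simp only: eq) simp
    ultimately show "(\<Sum>i. d i * t ^ i) / t ^ 6 = 1 / t^6 + d 1 / t^5 + d 2 / t^4 + d 3 / t^3
      + d 4 / t^2 + d 5 / t + d 6 + (\<Sum>i. d (i + 7) * t ^ Suc i)"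
      using t d0 by (simp add: add_divide_distrib eval_nat_numeral)
  qed
  have t': "0 < t2" "t1 \<le> 0.739" using t by auto
  have geo: "(\<lambda>i. t ^ Suc i) sums (t / (1 - t))" if "0 < t" "t \<le> 0.739" for t :: real
    using sums_mult[OF geometric_sums[of t], of t] that by simp
  have tail: "(\<Sum>i. d (i + 7) * t1 ^ Suc i) - (\<Sum>i. d (i + 7) * t2 ^ Suc i)
      \<ge> t1 / (1 - t1) - t2 / (1 - t2)"
  proof -
    have g: "(\<lambda>i. t1 ^ Suc i - t2 ^ Suc i) sums (t1 / (1 - t1) - t2 / (1 - t2))"
      using t t' by (intro sums_diff geo) auto
    have h: "(\<lambda>i. d (i + 7) * t1 ^ Suc i - d (i + 7) * t2 ^ Suc i) sums
        ((\<Sum>i. d (i + 7) * t1 ^ Suc i) - (\<Sum>i. d (i + 7) * t2 ^ Suc i))"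
      using t t' summ' by (intro sums_diff summable_sums) auto
    show ?thesis
    proof (rule sums_le[OF _ g h])
      fix i
      have "t1 ^ Suc i \<le> t2 ^ Suc i" using t by (intro power_mono) auto
      then have "d (i + 7) * (t2 ^ Suc i - t1 ^ Suc i) \<le> 1 * (t2 ^ Suc i - t1 ^ Suc i)"
        using d[of "i + 7"] by (intro mult_right_mono) auto
      then show "t1 ^ Suc i - t2 ^ Suc i \<le> d (i + 7) * t1 ^ Suc i - d (i + 7) * t2 ^ Suc i"
        by (simp add: algebra_simps)
    qed
  qed
  have low: "d j / t1 ^ m - d j / t2 ^ m \<ge> - (1 / t1 ^ m - 1 / t2 ^ m)" for j m
  proof -
    have "1 / t2 ^ m \<le> 1 / t1 ^ m" using t t' by (intro frac_le power_mono) auto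
    then have "- 1 * (1 / t1 ^ m - 1 / t2 ^ m) \<le> d j * (1 / t1 ^ m - 1 / t2 ^ m)"
      using d[of j] by (intro mult_right_mono) auto
    then show ?thesis by (simp add: algebra_simps)
  qed
  have low1: "d 1 / t1 ^ 5 - d 1 / t2 ^ 5 \<ge> 0"
    using t t' d1 by (auto intro!: frac_le power_mono)
  show ?thesis
    unfolding split[OF t(1) t'(2)] split[OF t'(1) t(3)]
    using comparison_function_decreasing[OF t] tail low1
      low[of 4 2] low[of 3 3] low[of 2 4] low[of 1 5]
    unfolding power_one_right by linarith
qed

text \<open>On the ray \<open>(\<beta>0, \<beta>1) = (t a, t b)\<close> the difference of the coding sums of \<open>x\<close>, which starts
with 1, and \<open>y\<close>, which starts with 0, is \<open>b t\<close> times a power series in \<open>t\<close>. As neither sequence has adjacent ones, multiplication by \<open>1 + t\<close>, which adds neighbouring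
coefficients, still leaves coefficients in \<open>[-1, 1]\<close>, and makes the linear coefficient nonnegative.\<close>
lemma ray_separation:
  fixes a b :: real
  assumes x: "isolated_ones x" "x 0" and y: "isolated_ones y" "\<not> y 0"
    and ab: "0 < a" "a \<le> 1" "0 < b" "b \<le> 1"
    and t: "0 < t1" "t1 \<le> t2" "t2 < 0.739"
  defines "g \<equiv> \<lambda>t. (1 + t) * (code_sum (t * a) (t * b) x - code_sum (t * a) (t * b) y) / (b * t ^ 7)"
  shows "g t1 - g t2 \<ge> 0.02 * (t2 - t1)"
proof -
  define c where "c z i = (of_bool (z i) * wt a b z i :: real)" for z :: "nat \<Rightarrow> bool" and i
  have c01: "0 \<le> c z i" "c z i \<le> 1" for z i
    using wt_le_1[of a b z i] ab by (auto simp: c_def)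
  have c_pair: "c z i = 0 \<or> c z (Suc i) = 0" if "isolated_ones z" for z i
    using that by (auto simp: c_def isolated_ones_def)
  define d where "d i = (case i of 0 \<Rightarrow> 1 | Suc j \<Rightarrow> (c x j + c x (Suc j)) - (c y j + c y (Suc j)))" for i
  have pair01: "0 \<le> c z i + c z (Suc i) \<and> c z i + c z (Suc i) \<le> 1" if "isolated_ones z" for z i
    using c01[of z i] c01[of z "Suc i"] c_pair[OF that, of i] by auto
  have cx0: "c x 0 = 1" and cy0: "c y 0 = 0"
    using x y by (auto simp: c_def)
  have cx1: "c x 1 = 0" using cx0 c_pair[OF x(1), of 0] by simp
  have d: "d 0 = 1" "0 \<le> d 1" "\<bar>d i\<bar> \<le> 1" for i
    using pair01[OF x(1), of "i - 1"] pair01[OF y(1), of "i - 1"] cx0 cx1 cy0 c01(2)[of y 1]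
    by (auto simp: d_def split: nat.splits)
  have g: "g t = (\<Sum>i. d i * t ^ i) / t ^ 6" if t: "0 < t" "t < 0.739" for t
  proof -
    have lt: "t * z < 1" if "0 < z" "z \<le> 1" for z
    proof -
      have "t * z \<le> t * 1" using t that by (intro mult_left_mono) auto
      also have "\<dots> < 1" using t by simp
      finally show ?thesis .
    qed
    have ta: "0 \<le> t * a" "t * a < 1" "0 \<le> t * b" "t * b < 1"
      using t ab lt[of a] lt[of b] by simp_all
    have eq: "of_bool (z i) * wt (t * a) (t * b) z i = c z i * t ^ i" for z i
      by (simp add: c_def wt_scale)
    have cs: "(\<lambda>i. c z i * t ^ i) sums (\<Sum>i. c z i * t ^ i)" for z
      using summable_code[OF ta, of z] unfolding eq by (rule summable_sums)
    have code: "code_sum (t * a) (t * b) z = t * b * (\<Sum>i. c z i * t ^ i)" for z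
      using code_sum_alt[OF ta, of z] unfolding eq .
    have cs': "(\<lambda>i. (c x i - c y i) * t ^ i) sums ((\<Sum>i. c x i * t ^ i) - (\<Sum>i. c y i * t ^ i))"
      using sums_diff[OF cs[of x] cs[of y]] by (simp add: algebra_simps)
    define f where "f = (\<Sum>i. c x i * t ^ i) - (\<Sum>i. c y i * t ^ i)"
    have "(\<lambda>i. (c x i - c y i) * t ^ i) sums f" using cs' by (simp add: f_def)
    then have s1: "(\<lambda>i. (c x (Suc i) - c y (Suc i)) * t ^ Suc i) sums (f - 1)"
      using sums_Suc_iff[of "\<lambda>i. (c x i - c y i) * t ^ i" "f - 1"] cx0 cy0 by simp
    moreover have s2: "(\<lambda>i. t * ((c x i - c y i) * t ^ i)) sums (t * f)"
      using cs' by (intro sums_mult) (simp add: f_def)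
    ultimately have "(\<lambda>i. d (Suc i) * t ^ Suc i) sums (t * f + (f - 1))"
      using sums_add[OF s2 s1] by (simp add: d_def algebra_simps)
    then have "(\<lambda>i. d i * t ^ i) sums ((1 + t) * f)"
      using sums_Suc_iff[of "\<lambda>i. d i * t ^ i" "t * f + (f - 1)"] d(1) by (simp add: algebra_simps)
    then have "(\<Sum>i. d i * t ^ i) = (1 + t) * f"
      by (rule sums_unique[symmetric])
    moreover have "code_sum (t * a) (t * b) x - code_sum (t * a) (t * b) y = t * b * f"
      unfolding code f_def by (simp only: right_diff_distrib)
    ultimately show ?thesis
      using t ab by (simp add: g_def field_simps eval_nat_numeral)
  qed
  show ?thesis
    using transversality[of d t1 t2] d t by (simp add: g)
qed

section \<open>Parameters for which two sequences nearly coincide\<close>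

lemma emeasure_lborel_le_diameter:
  fixes A :: "real set"
  assumes "\<And>x y. x \<in> A \<Longrightarrow> y \<in> A \<Longrightarrow> x \<le> y \<Longrightarrow> y - x \<le> D"
  shows "emeasure lborel A \<le> ennreal (2 * D)"
proof (cases "A = {}")
  case False
  then obtain x where x: "x \<in> A" by auto
  then have D: "0 \<le> D" using assms[of x x] by simp
  have "A \<subseteq> {x - D..x + D}"
    using assms[OF x] assms[OF _ x] D by (smt (verit, best) atLeastAtMost_iff subsetI)
  then have "emeasure lborel A \<le> emeasure lborel {x - D..x + D}"
    by (intro emeasure_mono) auto
  also have "\<dots> = ennreal (2 * D)" using D by simp
  finally show ?thesis .
qed simp

text \<open>The set has diameter at most \<open>200 r / (c1 c\<^sup>6)\<close>, where 200 = 4 / 0.02; an interval that contains it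
needs no more than twice this length.\<close>
lemma ray_measure:
  fixes a b c c1 r :: real
  assumes x: "isolated_ones x" "x 0" and y: "isolated_ones y" "\<not> y 0"
    and ab: "0 < a" "a \<le> 1" "0 < b" "b \<le> 1"
    and c: "0 < c" "0 < c1" "0 < r"
  shows "emeasure lborel {t. c < t \<and> t < 0.739 \<and> c1 < t * b \<and>
      \<bar>code_sum (t * a) (t * b) x - code_sum (t * a) (t * b) y\<bar> < r}
    \<le> ennreal (400 / (c1 * c ^ 6) * r)" (is "emeasure lborel ?A \<le> _")
proof -
  let ?f = "\<lambda>t. code_sum (t * a) (t * b) x - code_sum (t * a) (t * b) y"
  define g where "g t = (1 + t) * ?f t / (b * t ^ 7)" for t
  have g: "\<bar>g t\<bar> \<le> 2 * r / (c1 * c ^ 6)" if "t \<in> ?A" for t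
  proof -
    have t: "c < t" "t < 0.739" "c1 < t * b" "\<bar>?f t\<bar> < r" using that by auto
    have "\<bar>g t\<bar> = (1 + t) * \<bar>?f t\<bar> / ((t * b) * t ^ 6)"
      using t ab c by (simp add: g_def abs_mult eval_nat_numeral ac_simps)
    also have "\<dots> \<le> (2 * r) / (c1 * c ^ 6)"
      using t ab c by (intro frac_le mult_mono power_mono mult_pos_pos) auto
    finally show ?thesis .
  qed
  have "t2 - t1 \<le> 200 * r / (c1 * c ^ 6)" if "t1 \<in> ?A" "t2 \<in> ?A" "t1 \<le> t2" for t1 t2
  proof -
    have "0.02 * (t2 - t1) \<le> g t1 - g t2"
      using ray_separation[OF x y ab, of t1 t2] that c by (simp add: g_def)
    also have "\<dots> \<le> 4 * r / (c1 * c ^ 6)"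
      using g[OF that(1)] g[OF that(2)] by simp
    finally show ?thesis by simp
  qed
  then have "emeasure lborel ?A \<le> ennreal (2 * (200 * r / (c1 * c ^ 6)))"
    by (rule emeasure_lborel_le_diameter)
  then show ?thesis by simp
qed

lemma emeasure_lborel_scale:
  fixes t :: real
  assumes t: "0 < t" and B: "B \<in> sets borel"
  shows "emeasure lborel B = ennreal t * emeasure lborel {s. t * s \<in> B}"
proof -
  have "emeasure lborel B = (\<integral>\<^sup>+ y. indicator B y \<partial>lborel)" using B by simp
  also have "\<dots> = ennreal \<bar>t\<bar> * (\<integral>\<^sup>+ s. indicator B (0 + t * s) \<partial>lborel)"
    using t B by (intro nn_integral_real_affine) auto
  also have "(\<lambda>s. indicator B (0 + t * s) :: ennreal) = indicator {s. t * s \<in> B}"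
    by (auto simp: indicator_def)
  also have "(\<integral>\<^sup>+ s. indicator {s. t * s \<in> B} s \<partial>lborel) = emeasure lborel {s. t * s \<in> B}"
    using measurable_sets[of "\<lambda>s. t * s" borel borel B] B
    by (intro nn_integral_indicator) (auto simp: vimage_def)
  finally show ?thesis using t by simp
qed

text \<open>Integration over the sector \<open>0 < v \<le> u \<le> 1\<close> in the coordinates \<open>(t, t s)\<close>. The Jacobian \<open>t\<close> is
at most 1, so a bound on all rays carries over to the plane.\<close>
lemma emeasure_le_of_rays_fst:
  fixes A :: "(real \<times> real) set"
  assumes A: "A \<in> sets borel"
    and sub: "A \<subseteq> {(u, v). 0 < u \<and> u \<le> 1 \<and> 0 < v \<and> v \<le> u}"
    and rays: "\<And>s. 0 < s \<Longrightarrow> s \<le> 1 \<Longrightarrow> emeasure lborel {t. (t, t * s) \<in> A} \<le> K"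
  shows "emeasure lborel A \<le> K"
proof -
  have A': "A \<in> sets (lborel \<Otimes>\<^sub>M lborel)" using A by (simp only: lborel_prod sets_lborel)
  have sec: "emeasure lborel (Pair t -` A) \<le> (\<integral>\<^sup>+ s. indicator A (t, t * s) \<partial>lborel)" for t
  proof (cases "0 < t \<and> t \<le> 1")
    case True
    have B: "Pair t -` A \<in> sets borel"
      using sets_Pair1[OF A', of t] by simp
    have "emeasure lborel (Pair t -` A) = ennreal t * emeasure lborel {s. (t, t * s) \<in> A}"
      using emeasure_lborel_scale[OF _ B, of t] True by simp
    also have "\<dots> \<le> 1 * emeasure lborel {s. (t, t * s) \<in> A}"
      using True by (intro mult_right_mono) (auto simp: ennreal_le_1)
    also have "\<dots> = (\<integral>\<^sup>+ s. indicator {s. (t, t * s) \<in> A} s \<partial>lborel)"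
      using measurable_sets[of "\<lambda>s. t * s" borel borel, OF _ B]
      by (subst nn_integral_indicator) (auto simp: vimage_def)
    also have "\<dots> = (\<integral>\<^sup>+ s. indicator A (t, t * s) \<partial>lborel)"
      by (intro nn_integral_cong) (auto simp: indicator_def)
    finally show ?thesis .
  next
    case False
    then have "Pair t -` A = {}" using sub by auto
    then show ?thesis by simp
  qed
  have m: "(\<lambda>(t, s). indicator A (t, t * s) :: ennreal) \<in> borel_measurable (lborel \<Otimes>\<^sub>M lborel)"
  proof -
    have "(\<lambda>(t::real, s). (t, t * s)) \<in> borel_measurable borel"
      by (intro borel_measurable_continuous_onI) (auto intro!: continuous_intros simp: case_prod_beta)
    then show ?thesis
      using A by (simp add: lborel_prod case_prod_beta')
  qed
  have "emeasure lborel A = emeasure (lborel \<Otimes>\<^sub>M lborel) A" by (simp add: lborel_prod)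
  also have "\<dots> = (\<integral>\<^sup>+ t. emeasure lborel (Pair t -` A) \<partial>lborel)"
    using A' by (rule lborel.emeasure_pair_measure_alt)
  also have "\<dots> \<le> (\<integral>\<^sup>+ t. (\<integral>\<^sup>+ s. indicator A (t, t * s) \<partial>lborel) \<partial>lborel)"
    by (intro nn_integral_mono sec)
  also have "\<dots> = (\<integral>\<^sup>+ s. (\<integral>\<^sup>+ t. indicator A (t, t * s) \<partial>lborel) \<partial>lborel)"
    using lborel_pair.Fubini'[OF m] by simp
  also have "\<dots> \<le> (\<integral>\<^sup>+ s. K * indicator {0..1::real} s \<partial>lborel)"
  proof (intro nn_integral_mono)
    fix s :: real
    show "(\<integral>\<^sup>+ t. indicator A (t, t * s) \<partial>lborel) \<le> K * indicator {0..1} s"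
    proof (cases "0 < s \<and> s \<le> 1")
      case True
      have "(\<integral>\<^sup>+ t. indicator A (t, t * s) \<partial>lborel) = (\<integral>\<^sup>+ t. indicator {t. (t, t * s) \<in> A} t \<partial>lborel)"
        by (intro nn_integral_cong) (auto simp: indicator_def)
      also have "\<dots> = emeasure lborel {t. (t, t * s) \<in> A}"
      proof -
        have "(\<lambda>t. (t, t * s)) \<in> borel_measurable borel"
          by (intro borel_measurable_continuous_onI continuous_intros)
        from measurable_sets[OF this A] show ?thesis
          by (intro nn_integral_indicator) (auto simp: vimage_def)
      qed
      also have "\<dots> \<le> K" using rays True by simp
      finally show ?thesis using True by simp
    next
      case False
      then have "indicator A (t, t * s) = (0 :: ennreal)" for t
        using sub by (auto simp: indicator_def zero_less_mult_iff mult_le_cancel_left2)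
      then show ?thesis by simp
    qed
  qed
  also have "\<dots> = K" by (simp add: nn_integral_cmult_indicator)
  finally show ?thesis .
qed

lemma emeasure_lborel_swap:
  fixes A :: "(real \<times> real) set"
  assumes A: "A \<in> sets borel"
  shows "emeasure lborel A = emeasure lborel {(u, v). (v, u) \<in> A}"
proof -
  have "emeasure lborel A = emeasure (distr (lborel \<Otimes>\<^sub>M lborel) (lborel \<Otimes>\<^sub>M lborel) (\<lambda>(x, y). (y, x))) A"
    by (subst lborel_pair.distr_pair_swap[symmetric]) (simp add: lborel_prod)
  also have "\<dots> = emeasure (lborel \<Otimes>\<^sub>M lborel) ((\<lambda>(x, y). (y, x)) -` A \<inter> space (lborel \<Otimes>\<^sub>M lborel))"
    by (intro emeasure_distr measurable_pair_swap') (use A in \<open>simp only: lborel_prod sets_lborel\<close>)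
  also have "(\<lambda>(x, y). (y, x)) -` A \<inter> space (lborel \<Otimes>\<^sub>M lborel) = {(u, v). (v, u) \<in> A}"
    by (auto simp: space_pair_measure)
  finally show ?thesis by (simp add: lborel_prod)
qed

lemma borel_measurable_code_sum [measurable]:
  fixes f g :: "'b \<Rightarrow> real"
  assumes [measurable]: "f \<in> borel_measurable L" "g \<in> borel_measurable L" "\<And>i. Measurable.pred L (\<lambda>v. x v i)"
  shows "(\<lambda>v. code_sum (f v) (g v) (x v)) \<in> borel_measurable L"
proof -
  have [measurable]: "(\<lambda>v. if x v k then g v else f v) \<in> borel_measurable L" for k
    by measurable
  have [measurable]: "(\<lambda>v. of_bool (x v k) :: real) \<in> borel_measurable L" for k
    unfolding of_bool_def by measurable
  show ?thesis
    unfolding code_sum_def wt_def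
    by (intro borel_measurable_suminf borel_measurable_times borel_measurable_prod) measurable
qed

lemma borel_measurable_fst_snd [measurable]:
  "(fst :: real \<times> real \<Rightarrow> real) \<in> borel_measurable borel"
  "(snd :: real \<times> real \<Rightarrow> real) \<in> borel_measurable borel"
  by (intro borel_measurable_continuous_onI continuous_intros)+

lemma sets_box_code_sum:
  "{\<beta> \<in> {c0<..<0.739} \<times> {c1<..<0.739}.
      \<bar>code_sum (fst \<beta>) (snd \<beta>) x - code_sum (fst \<beta>) (snd \<beta>) y\<bar> < r} \<in> sets borel"
proof -
  have "{c0<..<0.739} \<times> {c1<..<0.739} \<in> sets (borel :: (real \<times> real) measure)"
    by (intro borel_open open_Times) auto
  then show ?thesis by measurable
qed

text \<open>The box is cut along the diagonal, so that on each half the larger of the two parameters serves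
as the ray coordinate \<open>t\<close> and the slope lies in \<open>(0, 1]\<close>.\<close>
lemma box_measure:
  fixes c0 c1 r :: real
  assumes x: "isolated_ones x" "x 0" and y: "isolated_ones y" "\<not> y 0"
    and c: "0 < c0" "0 < c1" "0 < r"
  shows "emeasure lborel {\<beta> \<in> {c0<..<0.739} \<times> {c1<..<0.739}.
      \<bar>code_sum (fst \<beta>) (snd \<beta>) x - code_sum (fst \<beta>) (snd \<beta>) y\<bar> < r}
    \<le> ennreal (800 / (c1 * min c0 c1 ^ 6) * r)" (is "emeasure lborel ?A \<le> _")
proof -
  define A where "A = ?A"
  define c where "c = min c0 c1"
  let ?D = "\<lambda>u v. \<bar>code_sum u v x - code_sum u v y\<bar>"
  have c_pos: "0 < c" using c by (simp add: c_def)
  have A [measurable]: "A \<in> sets borel"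
    unfolding A_def by (rule sets_box_code_sum)
  define A1 where "A1 = A \<inter> {\<beta>. snd \<beta> \<le> fst \<beta>}"
  define A2 where "A2 = A \<inter> {\<beta>. fst \<beta> \<le> snd \<beta>}"
  have "closed {\<beta>::real \<times> real. snd \<beta> \<le> fst \<beta>}" "closed {\<beta>::real \<times> real. fst \<beta> \<le> snd \<beta>}"
    by (intro closed_Collect_le continuous_intros)+
  then have A12 [measurable]: "A1 \<in> sets borel" "A2 \<in> sets borel"
    unfolding A1_def A2_def by auto
  let ?K = "ennreal (400 / (c1 * c ^ 6) * r)"
  have "emeasure lborel A1 \<le> ?K"
  proof (rule emeasure_le_of_rays_fst[OF A12(1)])
    fix s :: real assume s: "0 < s" "s \<le> 1"
    have "emeasure lborel {t. (t, t * s) \<in> A1}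
        \<le> emeasure lborel {t. c < t \<and> t < 0.739 \<and> c1 < t * s \<and> ?D (t * 1) (t * s) < r}"
    proof (rule emeasure_mono)
      show "{t. c < t \<and> t < 0.739 \<and> c1 < t * s \<and> ?D (t * 1) (t * s) < r} \<in> sets lborel"
        by measurable
    qed (auto simp: A1_def A_def c_def)
    also have "\<dots> \<le> ?K" using s c c_pos by (intro ray_measure[OF x y]) auto
    finally show "emeasure lborel {t. (t, t * s) \<in> A1} \<le> ?K" .
  qed (use c in \<open>auto simp: A1_def A_def\<close>)
  moreover have "emeasure lborel A2 \<le> ?K"
    unfolding emeasure_lborel_swap[OF A12(2)]
  proof (rule emeasure_le_of_rays_fst)
    have "(\<lambda>(u::real, v::real). (v, u)) \<in> borel_measurable borel"
      by (intro borel_measurable_continuous_onI) (auto intro!: continuous_intros simp: case_prod_beta)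
    from measurable_sets[OF this A12(2)] show "{(u, v). (v, u) \<in> A2} \<in> sets borel"
      by (simp add: vimage_def case_prod_beta')
    fix s :: real assume s: "0 < s" "s \<le> 1"
    have "emeasure lborel {t. (t, t * s) \<in> {(u, v). (v, u) \<in> A2}}
        \<le> emeasure lborel {t. c < t \<and> t < 0.739 \<and> c1 < t * 1 \<and> ?D (t * s) (t * 1) < r}"
    proof (rule emeasure_mono)
      show "{t. c < t \<and> t < 0.739 \<and> c1 < t * 1 \<and> ?D (t * s) (t * 1) < r} \<in> sets lborel"
        by measurable
    qed (auto simp: A2_def A_def c_def)
    also have "\<dots> \<le> ?K" using s c c_pos by (intro ray_measure[OF x y]) auto
    finally show "emeasure lborel {t. (t, t * s) \<in> {(u, v). (v, u) \<in> A2}} \<le> ?K" .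
  qed (use c in \<open>auto simp: A2_def A_def\<close>)
  moreover have "A = A1 \<union> A2" by (auto simp: A1_def A2_def)
  then have "emeasure lborel A \<le> emeasure lborel A1 + emeasure lborel A2"
    using emeasure_subadditive[of A1 lborel A2] by simp
  ultimately have "emeasure lborel A \<le> ?K + ?K"
    by (meson add_mono order_trans)
  also have "\<dots> = ennreal (800 / (c1 * c ^ 6) * r)"
    using c c_pos by (subst ennreal_plus[symmetric]) (auto simp: field_simps)
  finally show ?thesis by (simp add: A_def c_def)
qed

section \<open>Measures of bounded correlation energy\<close>

text \<open>Two balls of radius \<open>\<delta>\<close> meet only if their centres are closer than \<open>2 \<delta>\<close>, and then in a set of length
at most \<open>2 \<delta>\<close>.\<close>
lemma nn_integral_ball_mean_sq:
  fixes \<nu> :: "real measure"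
  assumes "finite_measure \<nu>" and sets [measurable_cong, simp]: "sets \<nu> = sets borel" and \<delta>: "0 < \<delta>"
  shows "(\<integral>\<^sup>+ y. emeasure \<nu> (ball y \<delta>) ^ 2 \<partial>lborel)
    \<le> ennreal (2 * \<delta>) * emeasure (\<nu> \<Otimes>\<^sub>M \<nu>) {p. \<bar>fst p - snd p\<bar> < 2 * \<delta>}"
proof -
  interpret finite_measure \<nu> by fact
  have space [simp]: "space \<nu> = UNIV" using sets_eq_imp_space_eq[OF sets] by simp
  interpret P: pair_sigma_finite \<nu> \<nu> ..
  interpret Q: pair_sigma_finite lborel "\<nu> \<Otimes>\<^sub>M \<nu>" ..
  let ?I = "\<lambda>y p. indicator {p. \<bar>fst p - y\<bar> < \<delta> \<and> \<bar>snd p - y\<bar> < \<delta>} p :: ennreal"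
  have m: "(\<lambda>(y, p). ?I y p) \<in> borel_measurable (lborel \<Otimes>\<^sub>M (\<nu> \<Otimes>\<^sub>M \<nu>))"
    unfolding indicator_def by measurable
  have "(\<integral>\<^sup>+ y. emeasure \<nu> (ball y \<delta>) ^ 2 \<partial>lborel) = (\<integral>\<^sup>+ y. (\<integral>\<^sup>+ p. ?I y p \<partial>(\<nu> \<Otimes>\<^sub>M \<nu>)) \<partial>lborel)"
  proof (intro nn_integral_cong)
    fix y :: real
    have "emeasure \<nu> (ball y \<delta>) ^ 2 = emeasure (\<nu> \<Otimes>\<^sub>M \<nu>) (ball y \<delta> \<times> ball y \<delta>)"
      by (subst emeasure_pair_measure_Times) (auto simp: power2_eq_square)
    also have "\<dots> = (\<integral>\<^sup>+ p. indicator (ball y \<delta> \<times> ball y \<delta>) p \<partial>(\<nu> \<Otimes>\<^sub>M \<nu>))"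
      by (intro nn_integral_indicator[symmetric] pair_measureI) auto
    also have "\<dots> = (\<integral>\<^sup>+ p. ?I y p \<partial>(\<nu> \<Otimes>\<^sub>M \<nu>))"
      by (intro nn_integral_cong) (auto simp: indicator_def dist_real_def)
    finally show "emeasure \<nu> (ball y \<delta>) ^ 2 = (\<integral>\<^sup>+ p. ?I y p \<partial>(\<nu> \<Otimes>\<^sub>M \<nu>))" .
  qed
  also have "\<dots> = (\<integral>\<^sup>+ p. (\<integral>\<^sup>+ y. ?I y p \<partial>lborel) \<partial>(\<nu> \<Otimes>\<^sub>M \<nu>))"
    using Q.Fubini'[OF m] by simp
  also have "\<dots> \<le> (\<integral>\<^sup>+ p. ennreal (2 * \<delta>) * indicator {p. \<bar>fst p - snd p\<bar> < 2 * \<delta>} p \<partial>(\<nu> \<Otimes>\<^sub>M \<nu>))"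
  proof (intro nn_integral_mono)
    fix p :: "real \<times> real"
    have "(\<integral>\<^sup>+ y. ?I y p \<partial>lborel) \<le> (\<integral>\<^sup>+ y. indicator {p. \<bar>fst p - snd p\<bar> < 2 * \<delta>} p
        * indicator {fst p - \<delta> .. fst p + \<delta>} y \<partial>lborel)"
      by (intro nn_integral_mono) (auto simp: indicator_def)
    also have "\<dots> = indicator {p. \<bar>fst p - snd p\<bar> < 2 * \<delta>} p * ennreal (2 * \<delta>)"
      using \<delta> by (simp add: nn_integral_cmult_indicator)
    finally show "(\<integral>\<^sup>+ y. ?I y p \<partial>lborel)
      \<le> ennreal (2 * \<delta>) * indicator {p. \<bar>fst p - snd p\<bar> < 2 * \<delta>} p"
      by (simp add: mult.commute)
  qed
  also have "\<dots> = ennreal (2 * \<delta>) * emeasure (\<nu> \<Otimes>\<^sub>M \<nu>) {p. \<bar>fst p - snd p\<bar> < 2 * \<delta>}"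
  proof (rule nn_integral_cmult_indicator)
    have "{p \<in> space (\<nu> \<Otimes>\<^sub>M \<nu>). \<bar>fst p - snd p\<bar> < 2 * \<delta>} \<in> sets (\<nu> \<Otimes>\<^sub>M \<nu>)"
      by measurable
    then show "{p. \<bar>fst p - snd p\<bar> < 2 * \<delta>} \<in> sets (\<nu> \<Otimes>\<^sub>M \<nu>)"
      by (simp add: space_pair_measure)
  qed
  finally show ?thesis .
qed

text \<open>The correlation integral \<open>(\<nu> \<times> \<nu>) {|x - y| < 2r}\<close> is at most \<open>C r\<close> for infinitely many of the
radii \<open>r = 1 / 2 ^ k\<close>. The factor 2 is the one produced by averaging over balls of radius \<open>r\<close>.\<close>
definition bounded_energy :: "real measure \<Rightarrow> real \<Rightarrow> bool" where
  "bounded_energy \<nu> C \<longleftrightarrow>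
     (\<exists>\<^sub>F k in sequentially. emeasure (\<nu> \<Otimes>\<^sub>M \<nu>) {p. \<bar>fst p - snd p\<bar> < 2 * (1 / 2 ^ k)} \<le> ennreal (C / 2 ^ k))"

text \<open>Let \<open>F k\<close> be the density of \<open>\<nu>\<close> averaged over balls of radius \<open>1 / 2 ^ k\<close>. Its square integral is
controlled by the correlation integral, so \<open>\<integral> \<phi> F k \<le> \<integral> \<phi>\<^sup>2 / 2 + C / 4\<close> for infinitely many \<open>k\<close>.
Lower semicontinuity and Fatou's lemma give the same bound for \<open>\<integral> \<phi> d\<nu>\<close>. Both indicators of
open sets and continuous functions are covered.\<close>
lemma nn_integral_le_of_energy:
  fixes \<nu> :: "real measure" and \<phi> :: "real \<Rightarrow> real"
  assumes fin: "finite_measure \<nu>" and sets [measurable_cong, simp]: "sets \<nu> = sets borel"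
    and C: "0 \<le> C" "bounded_energy \<nu> C"
    and \<phi> [measurable]: "\<phi> \<in> borel_measurable borel" and \<phi>_nonneg: "\<And>x. 0 \<le> \<phi> x"
    and lsc: "\<And>x c. c < \<phi> x \<Longrightarrow> \<forall>\<^sub>F y in nhds x. c < \<phi> y"
  shows "(\<integral>\<^sup>+ x. \<phi> x \<partial>\<nu>) \<le> (\<integral>\<^sup>+ x. ennreal ((\<phi> x)\<^sup>2 / 2) \<partial>lborel) + ennreal (C / 4)"
proof -
  interpret finite_measure \<nu> by fact
  have space [simp]: "space \<nu> = UNIV" using sets_eq_imp_space_eq[OF sets] by simp
  interpret P: pair_sigma_finite \<nu> lborel ..
  define \<delta> where "\<delta> k = (1 / 2 ^ k :: real)" for k :: nat
  have \<delta>: "0 < \<delta> k" for k by (simp add: \<delta>_def)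
  have \<delta>0: "\<delta> \<longlonglongrightarrow> 0"
    using LIMSEQ_power_zero[of "1 / 2 :: real"] by (simp add: \<delta>_def[abs_def] power_one_over)
  define u where "u k x = (\<integral>\<^sup>+ y. ennreal (\<phi> y / (2 * \<delta> k)) * indicator (ball x (\<delta> k)) y \<partial>lborel)" for k x
  have ind [measurable]: "(\<lambda>(x, y). indicator (ball x (\<delta> k)) y :: ennreal) \<in> borel_measurable (\<nu> \<Otimes>\<^sub>M lborel)" for k
    unfolding indicator_def mem_ball dist_real_def by measurable
  have m: "(\<lambda>(x, y). ennreal (\<phi> y / (2 * \<delta> k)) * indicator (ball x (\<delta> k)) y) \<in> borel_measurable (\<nu> \<Otimes>\<^sub>M lborel)" for k
    using ind[of k] by measurable
  have um [measurable]: "u k \<in> borel_measurable \<nu>" for k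
    unfolding u_def using lborel.borel_measurable_nn_integral[OF m[of k]] by simp
  have low: "ennreal (\<phi> x) \<le> liminf (\<lambda>k. u k x)" for x
  proof (rule dense_le)
    fix c' assume "c' < ennreal (\<phi> x)"
    then obtain c where c: "c' = ennreal c" "0 \<le> c" "c < \<phi> x"
      using \<phi>_nonneg by (cases c') (auto simp: ennreal_less_iff)
    from lsc[OF c(3)] obtain e where e: "0 < e" "\<And>y. dist y x < e \<Longrightarrow> c < \<phi> y"
      by (auto simp: eventually_nhds_metric)
    have "\<forall>\<^sub>F k in sequentially. \<delta> k < e"
      using \<delta>0 e(1) by (rule order_tendstoD)
    then have "\<forall>\<^sub>F k in sequentially. c' \<le> u k x"
    proof eventually_elim
      fix k assume k: "\<delta> k < e"
      have "c' = ennreal (c / (2 * \<delta> k)) * emeasure lborel (ball x (\<delta> k))"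
        using \<delta>[of k] c by (simp add: ball_eq_greaterThanLessThan ennreal_mult[symmetric])
      also have "\<dots> = (\<integral>\<^sup>+ y. ennreal (c / (2 * \<delta> k)) * indicator (ball x (\<delta> k)) y \<partial>lborel)"
        by (rule nn_integral_cmult_indicator[symmetric]) auto
      also have "\<dots> \<le> u k x"
        unfolding u_def
      proof (intro nn_integral_mono)
        fix y
        show "ennreal (c / (2 * \<delta> k)) * indicator (ball x (\<delta> k)) y
            \<le> ennreal (\<phi> y / (2 * \<delta> k)) * indicator (ball x (\<delta> k)) y"
        proof (cases "y \<in> ball x (\<delta> k)")
          case True
          then have "c < \<phi> y" using k by (intro e(2)) (simp add: dist_commute)
          then have "c / (2 * \<delta> k) \<le> \<phi> y / (2 * \<delta> k)"
            using \<delta>[of k] by (intro divide_right_mono) auto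
          then show ?thesis using True by (simp add: ennreal_leI)
        qed simp
      qed
      finally show "c' \<le> u k x" .
    qed
    then show "c' \<le> liminf (\<lambda>k. u k x)" by (rule Liminf_bounded)
  qed
  let ?B = "(\<integral>\<^sup>+ x. ennreal ((\<phi> x)\<^sup>2 / 2) \<partial>lborel) + ennreal (C / 4)"
  have upper: "(\<integral>\<^sup>+ x. u k x \<partial>\<nu>) \<le> ?B"
    if k: "emeasure (\<nu> \<Otimes>\<^sub>M \<nu>) {p. \<bar>fst p - snd p\<bar> < 2 * (1 / 2 ^ k)} \<le> ennreal (C / 2 ^ k)" for k
  proof -
    define F where "F y = measure \<nu> (ball y (\<delta> k)) / (2 * \<delta> k)" for y
    have bm: "(\<lambda>y. emeasure \<nu> (ball y (\<delta> k))) \<in> borel_measurable lborel"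
    proof -
      have "(\<lambda>y. \<integral>\<^sup>+ x. indicator (ball x (\<delta> k)) y \<partial>\<nu>) \<in> borel_measurable lborel"
        unfolding indicator_def mem_ball dist_real_def by measurable
      moreover have "(\<integral>\<^sup>+ x. indicator (ball x (\<delta> k)) y \<partial>\<nu>) = emeasure \<nu> (ball y (\<delta> k))" for y
      proof -
        have "(\<lambda>x. indicator (ball x (\<delta> k)) y :: ennreal) = indicator (ball y (\<delta> k))"
          by (auto simp: indicator_def dist_commute)
        then show ?thesis by simp
      qed
      ultimately show ?thesis by simp
    qed
    then have Fm [measurable]: "F \<in> borel_measurable lborel"
      unfolding F_def[abs_def] measure_def by measurable
    have "(\<integral>\<^sup>+ x. u k x \<partial>\<nu>)
        = (\<integral>\<^sup>+ y. (\<integral>\<^sup>+ x. ennreal (\<phi> y / (2 * \<delta> k)) * indicator (ball x (\<delta> k)) y \<partial>\<nu>) \<partial>lborel)"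
      unfolding u_def using P.Fubini'[OF m[of k]] by simp
    also have "\<dots> = (\<integral>\<^sup>+ y. ennreal (\<phi> y * F y) \<partial>lborel)"
    proof (intro nn_integral_cong)
      fix y :: real
      have "(\<integral>\<^sup>+ x. ennreal (\<phi> y / (2 * \<delta> k)) * indicator (ball x (\<delta> k)) y \<partial>\<nu>)
          = (\<integral>\<^sup>+ x. ennreal (\<phi> y / (2 * \<delta> k)) * indicator (ball y (\<delta> k)) x \<partial>\<nu>)"
        by (intro nn_integral_cong) (auto simp: indicator_def dist_commute)
      also have "\<dots> = ennreal (\<phi> y / (2 * \<delta> k)) * emeasure \<nu> (ball y (\<delta> k))"
        by (rule nn_integral_cmult_indicator) simp
      also have "\<dots> = ennreal (\<phi> y * F y)"
        using \<delta>[of k] \<phi>_nonneg[of y] by (simp add: F_def emeasure_eq_measure ennreal_mult[symmetric])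
      finally show "(\<integral>\<^sup>+ x. ennreal (\<phi> y / (2 * \<delta> k)) * indicator (ball x (\<delta> k)) y \<partial>\<nu>) = ennreal (\<phi> y * F y)" .
    qed
    also have "\<dots> \<le> (\<integral>\<^sup>+ y. ennreal ((\<phi> y)\<^sup>2 / 2) + ennreal ((F y)\<^sup>2 / 2) \<partial>lborel)"
    proof (intro nn_integral_mono)
      fix y
      have "\<phi> y * F y \<le> (\<phi> y)\<^sup>2 / 2 + (F y)\<^sup>2 / 2"
        using sum_squares_bound[of "\<phi> y" "F y"] by simp
      then have "ennreal (\<phi> y * F y) \<le> ennreal ((\<phi> y)\<^sup>2 / 2 + (F y)\<^sup>2 / 2)"
        by (rule ennreal_leI)
      then show "ennreal (\<phi> y * F y) \<le> ennreal ((\<phi> y)\<^sup>2 / 2) + ennreal ((F y)\<^sup>2 / 2)"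
        by simp
    qed
    also have "\<dots> = (\<integral>\<^sup>+ y. ennreal ((\<phi> y)\<^sup>2 / 2) \<partial>lborel) + (\<integral>\<^sup>+ y. ennreal ((F y)\<^sup>2 / 2) \<partial>lborel)"
      by (intro nn_integral_add) auto
    also have "(\<integral>\<^sup>+ y. ennreal ((F y)\<^sup>2 / 2) \<partial>lborel) \<le> ennreal (C / 4)"
    proof -
      have "(\<integral>\<^sup>+ y. ennreal ((F y)\<^sup>2 / 2) \<partial>lborel)
          = (\<integral>\<^sup>+ y. ennreal (1 / (8 * (\<delta> k)\<^sup>2)) * emeasure \<nu> (ball y (\<delta> k)) ^ 2 \<partial>lborel)"
        using \<delta>[of k]
        by (intro nn_integral_cong)
          (auto simp: F_def emeasure_eq_measure ennreal_power ennreal_mult[symmetric] power_divide power_mult_distrib)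
      also have "\<dots> = ennreal (1 / (8 * (\<delta> k)\<^sup>2)) * (\<integral>\<^sup>+ y. emeasure \<nu> (ball y (\<delta> k)) ^ 2 \<partial>lborel)"
        using bm by (intro nn_integral_cmult) auto
      also have "\<dots> \<le> ennreal (1 / (8 * (\<delta> k)\<^sup>2)) * (ennreal (2 * \<delta> k) * ennreal (C / 2 ^ k))"
      proof (rule mult_left_mono)
        have "emeasure (\<nu> \<Otimes>\<^sub>M \<nu>) {p. \<bar>fst p - snd p\<bar> < 2 * \<delta> k} \<le> ennreal (C / 2 ^ k)"
          using k by (simp only: \<delta>_def)
        then have "ennreal (2 * \<delta> k) * emeasure (\<nu> \<Otimes>\<^sub>M \<nu>) {p. \<bar>fst p - snd p\<bar> < 2 * \<delta> k}
            \<le> ennreal (2 * \<delta> k) * ennreal (C / 2 ^ k)"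
          by (rule mult_left_mono) simp
        with nn_integral_ball_mean_sq[OF fin sets \<delta>[of k]]
        show "(\<integral>\<^sup>+ y. emeasure \<nu> (ball y (\<delta> k)) ^ 2 \<partial>lborel) \<le> ennreal (2 * \<delta> k) * ennreal (C / 2 ^ k)"
          by (rule order_trans)
      qed simp
      also have "\<dots> = ennreal (1 / (8 * (\<delta> k)\<^sup>2) * (2 * \<delta> k * (C / 2 ^ k)))"
      proof -
        have pos: "0 \<le> 1 / (8 * (\<delta> k)\<^sup>2)" "0 \<le> 2 * \<delta> k" "0 \<le> C / 2 ^ k"
          using \<delta>[of k] C by auto
        show ?thesis
          by (simp only: ennreal_mult[OF pos(1) mult_nonneg_nonneg[OF pos(2,3)]] ennreal_mult[OF pos(2,3)])
      qed
      also have "1 / (8 * (\<delta> k)\<^sup>2) * (2 * \<delta> k * (C / 2 ^ k)) = C / 4"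
        by (simp add: \<delta>_def field_simps power2_eq_square)
      finally show ?thesis .
    qed
    finally show ?thesis by (simp add: add_left_mono)
  qed
  have "(\<integral>\<^sup>+ x. \<phi> x \<partial>\<nu>) \<le> (\<integral>\<^sup>+ x. liminf (\<lambda>k. u k x) \<partial>\<nu>)"
    by (intro nn_integral_mono low)
  also have "\<dots> \<le> liminf (\<lambda>k. \<integral>\<^sup>+ x. u k x \<partial>\<nu>)"
    by (intro nn_integral_liminf um)
  also have "\<dots> \<le> ?B"
  proof (rule ccontr)
    assume "\<not> ?thesis"
    then have "?B < liminf (\<lambda>k. \<integral>\<^sup>+ x. u k x \<partial>\<nu>)" by simp
    then have "\<forall>\<^sub>F k in sequentially. ?B < (\<integral>\<^sup>+ x. u k x \<partial>\<nu>)" by (rule less_LiminfD)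
    then have "\<forall>\<^sub>F k in sequentially.
        emeasure (\<nu> \<Otimes>\<^sub>M \<nu>) {p. \<bar>fst p - snd p\<bar> < 2 * (1 / 2 ^ k)} \<le> ennreal (C / 2 ^ k) \<longrightarrow> False"
    proof eventually_elim
      fix k assume "?B < (\<integral>\<^sup>+ x. u k x \<partial>\<nu>)"
      then show "emeasure (\<nu> \<Otimes>\<^sub>M \<nu>) {p. \<bar>fst p - snd p\<bar> < 2 * (1 / 2 ^ k)} \<le> ennreal (C / 2 ^ k) \<longrightarrow> False"
        using upper[of k] leD by blast
    qed
    then have "\<exists>\<^sub>F k in sequentially. False"
      using C(2) unfolding bounded_energy_def by (rule frequently_rev_mp[rotated])
    then show False by simp
  qed
  finally show ?thesis .
qed

text \<open>Applied to \<open>l\<close> times the indicator of an open set \<open>U\<close> that covers a null set, the energy bound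
reads \<open>l \<nu>(U) \<le> l\<^sup>2 |U| / 2 + C / 4\<close>; here \<open>l\<close> may be large once \<open>|U|\<close> is small.\<close>
lemma absolutely_continuous_of_energy:
  fixes \<nu> :: "real measure"
  assumes fin: "finite_measure \<nu>" and sets [simp]: "sets \<nu> = sets borel"
    and C: "0 \<le> C" "bounded_energy \<nu> C"
  shows "absolutely_continuous lborel \<nu>"
  unfolding absolutely_continuous_def
proof
  interpret finite_measure \<nu> by fact
  fix N assume N: "N \<in> null_sets (lborel :: real measure)"
  have open_bound: "l * measure \<nu> U \<le> l\<^sup>2 * measure lborel U / 2 + C / 4"
    if U: "open U" "emeasure lborel U < \<infinity>" and l: "0 < l" for U :: "real set" and l
  proof -
    have "(\<integral>\<^sup>+ x. ennreal (l * indicator U x) \<partial>\<nu>)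
        \<le> (\<integral>\<^sup>+ x. ennreal ((l * indicator U x)\<^sup>2 / 2) \<partial>lborel) + ennreal (C / 4)"
    proof (rule nn_integral_le_of_energy[OF fin sets C])
      show "(\<lambda>x. l * indicator U x) \<in> borel_measurable borel"
        using U by (intro borel_measurable_times borel_measurable_indicator) auto
      fix x c :: real assume c: "c < l * indicator U x"
      show "\<forall>\<^sub>F y in nhds x. c < l * indicator U y"
      proof (cases "x \<in> U")
        case True
        then have "\<forall>\<^sub>F y in nhds x. y \<in> U" using U by (simp add: eventually_nhds) blast
        then show ?thesis by eventually_elim (use c True in simp)
      next
        case False
        then have "c < l * indicator U y" for y
          using c l by (auto simp: indicator_def)
        then show ?thesis by simp
      qed
    qed (use l in auto)
    also have "(\<integral>\<^sup>+ x. ennreal (l * indicator U x) \<partial>\<nu>) = (\<integral>\<^sup>+ x. ennreal l * indicator U x \<partial>\<nu>)"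
      by (intro nn_integral_cong) (auto simp: indicator_def)
    also have "\<dots> = ennreal (l * measure \<nu> U)"
      using l U by (subst nn_integral_cmult_indicator) (auto simp: emeasure_eq_measure ennreal_mult)
    also have "(\<integral>\<^sup>+ x. ennreal ((l * indicator U x)\<^sup>2 / 2) \<partial>lborel)
        = (\<integral>\<^sup>+ x. ennreal (l\<^sup>2 / 2) * indicator U x \<partial>lborel)"
      by (intro nn_integral_cong) (auto simp: indicator_def)
    also have "\<dots> = ennreal (l\<^sup>2 * measure lborel U / 2)"
      using l U by (subst nn_integral_cmult_indicator)
        (auto simp: emeasure_eq_ennreal_measure ennreal_mult[symmetric])
    finally show ?thesis using C by (simp add: ennreal_plus[symmetric] del: ennreal_plus)
  qed
  have N': "N \<in> sets borel" "emeasure lborel N = 0" using N by auto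
  have small: "measure \<nu> N \<le> e" if e: "0 < e" for e
  proof -
    define l where "l = (C + 1) / e"
    have l: "0 < l" using C e by (simp add: l_def)
    obtain U where U: "open U" "N \<subseteq> U" "emeasure lborel (U - N) < ennreal (1 / l\<^sup>2)"
      using outer_regular_lborel[OF N'(1), of "1 / l\<^sup>2"] l by auto
    have "emeasure lborel U = emeasure lborel (U - N)"
      using N U by (simp add: emeasure_Diff_null_set)
    then have mU: "emeasure lborel U < ennreal (1 / l\<^sup>2)" using U by simp
    then have fU: "emeasure lborel U < \<infinity>" by (rule order_less_trans) simp
    have "measure lborel U \<le> 1 / l\<^sup>2"
      using mU l by (simp add: measure_def enn2real_leI less_imp_le)
    then have "l\<^sup>2 * measure lborel U \<le> 1" using l by (simp add: field_simps)
    then have "l * measure \<nu> U \<le> C + 1"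
      using open_bound[OF U(1) fU l] C by simp
    also have "C + 1 = l * e" using e by (simp add: l_def)
    finally have "measure \<nu> U \<le> e" using l by (rule mult_left_le_imp_le)
    moreover have "measure \<nu> N \<le> measure \<nu> U"
      using U N' by (intro finite_measure_mono) auto
    ultimately show ?thesis by simp
  qed
  then have "measure \<nu> N = 0"
    by (metis dense_ge_bounded field_le_epsilon add_0 measure_nonneg order_antisym)
  then show "N \<in> null_sets \<nu>" using N' by (auto simp: null_sets_def emeasure_eq_measure)
qed

text \<open>For a truncation \<open>g\<close> of the density \<open>f\<close> the energy bound, extended from continuous functions to \<open>g\<close>
by almost everywhere approximation, gives
\<open>\<integral> g\<^sup>2 \<le> \<integral> g f = \<integral> g d\<nu> \<le> \<integral> g\<^sup>2 / 2 + C / 4\<close>. Since \<open>\<integral> g\<^sup>2\<close> is finite, it is at most \<open>C / 2\<close>,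
whatever the truncation.\<close>
lemma square_integrable_density_of_energy:
  fixes \<nu> :: "real measure"
  assumes fin: "finite_measure \<nu>" and sets [measurable_cong, simp]: "sets \<nu> = sets borel"
    and C: "0 \<le> C" "bounded_energy \<nu> C"
  shows "(\<integral>\<^sup>+ x. (RN_deriv lborel \<nu> x)\<^sup>2 \<partial>lborel) < \<infinity>"
proof -
  interpret finite_measure \<nu> by fact
  have ac: "absolutely_continuous lborel \<nu>"
    by (rule absolutely_continuous_of_energy[OF fin sets C])
  define f where "f = RN_deriv lborel \<nu>"
  have fm [measurable]: "f \<in> borel_measurable borel"
    using borel_measurable_RN_deriv[of lborel \<nu>] by (simp add: f_def)
  have f_fin: "AE x in lborel. f x \<noteq> \<infinity>"
    unfolding f_def using sigma_finite_measure_axioms ac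
    by (intro sigma_finite_measure.RN_deriv_finite[OF lborel.sigma_finite_measure_axioms]) auto
  define g where "g n x = min (enn2real (f x)) (real n) * indicator {- real n..real n} x" for n x
  have gm [measurable]: "g n \<in> borel_measurable borel" for n
    unfolding g_def by measurable
  have g_nonneg: "0 \<le> g n x" and g_le: "g n x \<le> n" for n x
    by (auto simp: g_def indicator_def)
  have g_fin: "(\<integral>\<^sup>+ x. ennreal ((g n x)\<^sup>2) \<partial>lborel) < \<infinity>" for n
  proof -
    have "(\<integral>\<^sup>+ x. ennreal ((g n x)\<^sup>2) \<partial>lborel) \<le> (\<integral>\<^sup>+ x. ennreal ((real n)\<^sup>2) * indicator {- real n..real n} x \<partial>lborel)"
      using g_nonneg g_le by (intro nn_integral_mono) (auto simp: g_def indicator_def intro!: ennreal_leI power_mono)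
    also have "\<dots> < \<infinity>"
      by (subst nn_integral_cmult_indicator) (auto simp: ennreal_mult_less_top)
    finally show ?thesis .
  qed
  have g_int: "(\<integral>\<^sup>+ x. g n x \<partial>\<nu>) \<le> (\<integral>\<^sup>+ x. ennreal ((g n x)\<^sup>2 / 2) \<partial>lborel) + ennreal (C / 4)" for n
  proof -
    have "g n measurable_on UNIV"
      by (intro lebesgue_measurable_imp_measurable_on_real) (auto intro: measurable_completion)
    then obtain N G where N: "negligible N" and G: "\<And>j. continuous_on UNIV (G j)"
      and lim: "\<And>x. x \<notin> N \<Longrightarrow> (\<lambda>j. G j x) \<longlonglongrightarrow> g n x"
      unfolding measurable_on_def by auto
    obtain N' where N': "N' \<in> null_sets lborel" "N \<subseteq> N'"
      using N by (auto simp: negligible_iff_null_sets null_sets_completion_iff2)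
    have lim_lborel: "AE x in lborel. (\<lambda>j. G j x) \<longlonglongrightarrow> g n x"
      using N' lim by (intro AE_I'[of N']) auto
    \<comment> \<open>Absolute continuity turns Lebesgue almost everywhere into \<open>\<nu>\<close>-almost everywhere.\<close>
    have lim_\<nu>: "AE x in \<nu>. (\<lambda>j. G j x) \<longlonglongrightarrow> g n x"
      using N' lim ac by (intro AE_I'[of N']) (auto simp: absolutely_continuous_def)
    \<comment> \<open>The approximants \<open>G j\<close> need be neither bounded nor compactly supported.\<close>
    define cut where "cut x = max 0 (min 1 (real n + 1 - \<bar>x\<bar>))" for x :: real
    define \<psi> where "\<psi> j x = max 0 (min (G j x) (real n)) * cut x" for j x
    have \<psi>_cont: "continuous_on UNIV (\<psi> j)" for j
      unfolding \<psi>_def cut_def using G by (intro continuous_intros)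
    then have \<psi>m [measurable]: "\<psi> j \<in> borel_measurable borel" for j
      by (rule borel_measurable_continuous_onI)
    have cut: "0 \<le> cut x" "cut x \<le> 1" for x by (auto simp: cut_def)
    have \<psi>_nonneg: "0 \<le> \<psi> j x" for j x using cut by (simp add: \<psi>_def)
    have \<psi>_le: "\<psi> j x \<le> real n * indicator {- real n - 1..real n + 1} x" for j x
    proof (cases "x \<in> {- real n - 1..real n + 1}")
      case True
      then show ?thesis
        using mult_mono[of "max 0 (min (G j x) (real n))" "real n" "cut x" 1] cut[of x] by (simp add: \<psi>_def)
    qed (auto simp: \<psi>_def cut_def)
    have \<psi>_lim: "(\<lambda>j. \<psi> j x) \<longlonglongrightarrow> g n x" if "(\<lambda>j. G j x) \<longlonglongrightarrow> g n x" for x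
    proof -
      have "(\<lambda>j. \<psi> j x) \<longlonglongrightarrow> max 0 (min (g n x) (real n)) * cut x"
        unfolding \<psi>_def by (intro tendsto_intros that)
      also have "max 0 (min (g n x) (real n)) * cut x = g n x"
        using g_nonneg[of n x] g_le[of n x] by (auto simp: g_def cut_def indicator_def)
      finally show ?thesis .
    qed
    have step: "(\<integral>\<^sup>+ x. \<psi> j x \<partial>\<nu>) \<le> (\<integral>\<^sup>+ x. ennreal ((\<psi> j x)\<^sup>2 / 2) \<partial>lborel) + ennreal (C / 4)" for j
    proof (rule nn_integral_le_of_energy[OF fin sets C])
      fix x c assume "c < \<psi> j x"
      moreover have "(\<psi> j \<longlongrightarrow> \<psi> j x) (nhds x)"
        using \<psi>_cont[of j] by (simp add: continuous_on_eq_continuous_at isCont_def tendsto_at_iff_tendsto_nhds)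
      ultimately show "\<forall>\<^sub>F y in nhds x. c < \<psi> j y" by (intro order_tendstoD(1))
    qed (auto intro: \<psi>_nonneg)
    have "(\<lambda>j. \<integral>\<^sup>+ x. \<psi> j x \<partial>\<nu>) \<longlonglongrightarrow> (\<integral>\<^sup>+ x. g n x \<partial>\<nu>)"
    proof (rule nn_integral_dominated_convergence[where w="\<lambda>_. ennreal (real n)"])
      show "AE x in \<nu>. ennreal (\<psi> j x) \<le> ennreal (real n)" for j
      proof (intro AE_I2 ennreal_leI)
        fix x
        have "real n * indicator {- real n - 1..real n + 1} x \<le> real n"
          by (simp add: indicator_def)
        with \<psi>_le[of j x] show "\<psi> j x \<le> real n" by linarith
      qed
      show "AE x in \<nu>. (\<lambda>j. ennreal (\<psi> j x)) \<longlonglongrightarrow> ennreal (g n x)"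
        using lim_\<nu> by eventually_elim (intro tendsto_ennrealI \<psi>_lim)
    qed (auto simp: emeasure_eq_measure ennreal_mult[symmetric])
    moreover have "(\<lambda>j. (\<integral>\<^sup>+ x. ennreal ((\<psi> j x)\<^sup>2 / 2) \<partial>lborel) + ennreal (C / 4))
        \<longlonglongrightarrow> (\<integral>\<^sup>+ x. ennreal ((g n x)\<^sup>2 / 2) \<partial>lborel) + ennreal (C / 4)"
    proof (intro tendsto_add tendsto_const
        nn_integral_dominated_convergence[where w="\<lambda>x. ennreal ((real n)\<^sup>2 / 2) * indicator {- real n - 1..real n + 1} x"])
      fix j
      show "AE x in lborel. ennreal ((\<psi> j x)\<^sup>2 / 2) \<le> ennreal ((real n)\<^sup>2 / 2) * indicator {- real n - 1..real n + 1} x"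
      proof (rule AE_I2)
        fix x
        have "(\<psi> j x)\<^sup>2 \<le> (real n * indicator {- real n - 1..real n + 1} x)\<^sup>2"
          using \<psi>_le[of j x] \<psi>_nonneg[of j x] by (intro power_mono)
        then show "ennreal ((\<psi> j x)\<^sup>2 / 2) \<le> ennreal ((real n)\<^sup>2 / 2) * indicator {- real n - 1..real n + 1} x"
          by (auto simp: indicator_def intro!: ennreal_leI split: if_splits)
      qed
      show "AE x in lborel. (\<lambda>j. ennreal ((\<psi> j x)\<^sup>2 / 2)) \<longlonglongrightarrow> ennreal ((g n x)\<^sup>2 / 2)"
        using lim_lborel
        by eventually_elim (intro tendsto_ennrealI tendsto_divide tendsto_power tendsto_const \<psi>_lim, simp_all)
      show "(\<integral>\<^sup>+ x. ennreal ((real n)\<^sup>2 / 2) * indicator {- real n - 1..real n + 1} x \<partial>lborel) < \<infinity>"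
        by (subst nn_integral_cmult_indicator) (auto simp: ennreal_mult_less_top)
    qed auto
    ultimately show ?thesis
      by (rule LIMSEQ_le) (use step in auto)
  qed
  have g_bound: "(\<integral>\<^sup>+ x. ennreal ((g n x)\<^sup>2) \<partial>lborel) \<le> ennreal (C / 2)" for n
  proof -
    let ?J = "\<integral>\<^sup>+ x. ennreal ((g n x)\<^sup>2) \<partial>lborel"
    have "?J \<le> (\<integral>\<^sup>+ x. f x * ennreal (g n x) \<partial>lborel)"
    proof (intro nn_integral_mono)
      fix x
      have "ennreal (g n x) \<le> f x"
      proof (cases "f x")
        case (real r)
        then show ?thesis
          by (auto simp: g_def indicator_def intro!: ennreal_leI)
      qed simp
      then have "ennreal (g n x) * ennreal (g n x) \<le> f x * ennreal (g n x)"
        by (intro mult_right_mono) auto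
      then show "ennreal ((g n x)\<^sup>2) \<le> f x * ennreal (g n x)"
        using g_nonneg[of n x] by (simp add: power2_eq_square ennreal_mult)
    qed
    also have "\<dots> = (\<integral>\<^sup>+ x. g n x \<partial>\<nu>)"
      unfolding f_def by (intro sigma_finite_measure.RN_deriv_nn_integral[OF lborel.sigma_finite_measure_axioms, symmetric] ac) auto
    also have "\<dots> \<le> (\<integral>\<^sup>+ x. ennreal ((g n x)\<^sup>2 / 2) \<partial>lborel) + ennreal (C / 4)" by (rule g_int)
    also have "(\<integral>\<^sup>+ x. ennreal ((g n x)\<^sup>2 / 2) \<partial>lborel) = (\<integral>\<^sup>+ x. ennreal (1 / 2) * ennreal ((g n x)\<^sup>2) \<partial>lborel)"
      by (intro nn_integral_cong) (simp only: ennreal_mult[symmetric] zero_le_power2 zero_le_divide_1_iff zero_le_numeral, simp)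
    also have "\<dots> = ennreal (1 / 2) * ?J" by (intro nn_integral_cmult) auto
    finally have *: "?J \<le> ennreal (1 / 2) * ?J + ennreal (C / 4)" .
    obtain j where j: "?J = ennreal j" "0 \<le> j"
      using g_fin[of n] by (cases ?J) auto
    have "ennreal (1 / 2) * ennreal j = ennreal (1 / 2 * j)"
      using j by (intro ennreal_mult[symmetric]) auto
    then have "ennreal j \<le> ennreal (1 / 2 * j + C / 4)"
      using * j C by (simp only: ennreal_plus)
    then have "j \<le> C / 2" using j C by (subst (asm) ennreal_le_iff) auto
    then show ?thesis by (simp add: j ennreal_leI)
  qed
  have "(\<integral>\<^sup>+ x. (f x)\<^sup>2 \<partial>lborel) \<le> (\<integral>\<^sup>+ x. liminf (\<lambda>n. ennreal ((g n x)\<^sup>2)) \<partial>lborel)"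
  proof (rule nn_integral_mono_AE)
    show "AE x in lborel. (f x)\<^sup>2 \<le> liminf (\<lambda>n. ennreal ((g n x)\<^sup>2))"
      using f_fin
    proof eventually_elim
      fix x assume "f x \<noteq> \<infinity>"
      then obtain r where r: "f x = ennreal r" "0 \<le> r" by (cases "f x") auto
      obtain m :: nat where m: "max r \<bar>x\<bar> \<le> real m" using real_arch_simple by blast
      have "\<forall>\<^sub>F n in sequentially. (f x)\<^sup>2 \<le> ennreal ((g n x)\<^sup>2)"
        using eventually_ge_at_top[of m]
      proof eventually_elim
        fix n assume "m \<le> n"
        then have "real m \<le> real n" by simp
        then have "g n x = r"
          using m r by (auto simp: g_def indicator_def min_def)
        then show "(f x)\<^sup>2 \<le> ennreal ((g n x)\<^sup>2)" using r by (simp add: ennreal_power)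
      qed
      then show "(f x)\<^sup>2 \<le> liminf (\<lambda>n. ennreal ((g n x)\<^sup>2))" by (rule Liminf_bounded)
    qed
  qed
  also have "\<dots> \<le> liminf (\<lambda>n. \<integral>\<^sup>+ x. ennreal ((g n x)\<^sup>2) \<partial>lborel)"
    by (intro nn_integral_liminf) auto
  also have "\<dots> \<le> liminf (\<lambda>n::nat. ennreal (C / 2))"
    by (intro Liminf_mono always_eventually allI g_bound)
  also have "\<dots> < \<infinity>" by (simp add: Liminf_const)
  finally show ?thesis by (simp add: f_def)
qed

section \<open>Correlation energy integrated over a box of parameters\<close>

text \<open>The sum on the right dominates its term for the length \<open>n\<close> of the common prefix, where the
difference of the coding sums is the prefix ratio times the difference for the shifted sequences.
For equal sequences the sum is infinite and the bound is trivial, so the diagonal needs no separate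
treatment later.\<close>
lemma box_measure_le_overlap:
  fixes c0 c1 r :: real
  assumes x: "isolated_ones x" and y: "isolated_ones y" and c: "0 < c0" "c0 < 1" "0 < c1" "c1 < 1" and r: "0 < r"
  shows "emeasure lborel {\<beta> \<in> {c0<..<0.739} \<times> {c1<..<0.739}.
      \<bar>code_sum (fst \<beta>) (snd \<beta>) x - code_sum (fst \<beta>) (snd \<beta>) y\<bar> < r}
    \<le> ennreal (800 / (c1 * min c0 c1 ^ 6) * r) *
      (\<Sum>n. ennreal (of_bool (\<forall>k<n. x k = y k) / wt c0 c1 x n))"
    (is "emeasure lborel ?A \<le> ennreal (?K * r) * (\<Sum>n. ?t n)")
proof (cases "x = y")
  case True
  have "(\<Sum>n. ?t n) = \<top>"
  proof (rule ccontr)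
    assume "(\<Sum>n. ?t n) \<noteq> \<top>"
    then obtain m :: nat where m: "(\<Sum>n. ?t n) < of_nat m"
      using ennreal_Ex_less_of_nat less_top by blast
    have "1 \<le> ?t n" for n
      using wt_le_1[of c0 c1 x n] wt_pos[of c0 c1 x n] c True by (simp add: divide_simps)
    then have "(\<Sum>n<m. 1) \<le> (\<Sum>n<m. ?t n)" by (intro sum_mono)
    also have "\<dots> \<le> (\<Sum>n. ?t n)" by (intro sum_le_suminf) auto
    finally show False using m by simp
  qed
  moreover have "0 < ?K * r" using c r by simp
  then have "ennreal (?K * r) \<noteq> 0" by (simp only: ennreal_eq_0_iff not_le)
  then have "ennreal (?K * r) * \<top> = \<top>" by (simp only: ennreal_mult_top if_False)
  ultimately show ?thesis by (simp only: top_greatest)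
next
  case False
  then obtain m where "x m \<noteq> y m" by auto
  define n where "n = (LEAST k. x k \<noteq> y k)"
  have n: "x n \<noteq> y n" unfolding n_def by (rule LeastI) fact
  have agree: "x k = y k" if "k < n" for k
    using not_less_Least[of k "\<lambda>k. x k \<noteq> y k"] that by (auto simp: n_def)
  let ?x = "\<lambda>k. x (k + n)" and ?y = "\<lambda>k. y (k + n)"
  define r' where "r' = r / wt c0 c1 x n"
  have w: "0 < wt c0 c1 x n" using c by (intro wt_pos)
  have r': "0 < r'" using w r by (simp add: r'_def)
  have isolated_ones: "isolated_ones ?x" "isolated_ones ?y" using x y by (auto simp: isolated_ones_def)
  have "?A \<subseteq> {\<beta> \<in> {c0<..<0.739} \<times> {c1<..<0.739}.
      \<bar>code_sum (fst \<beta>) (snd \<beta>) ?x - code_sum (fst \<beta>) (snd \<beta>) ?y\<bar> < r'}"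
  proof
    fix \<beta> assume \<beta>: "\<beta> \<in> ?A"
    then obtain u v where uv: "\<beta> = (u, v)" "c0 < u" "u < 0.739" "c1 < v" "v < 0.739"
        "\<bar>code_sum u v x - code_sum u v y\<bar> < r" by auto
    let ?D = "code_sum u v ?x - code_sum u v ?y"
    have "code_sum u v x - code_sum u v y = wt u v x n * ?D"
      using uv c agree by (intro code_sum_diff_prefix) auto
    then have "wt u v x n * \<bar>?D\<bar> < r"
      using uv c wt_pos[of u v x n] by (simp add: abs_mult)
    moreover have "wt c0 c1 x n * \<bar>?D\<bar> \<le> wt u v x n * \<bar>?D\<bar>"
      using uv c by (intro mult_right_mono wt_mono) auto
    ultimately have "wt c0 c1 x n * \<bar>?D\<bar> < r" by linarith
    then have "\<bar>?D\<bar> < r'" using w by (simp add: r'_def field_simps)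
    then show "\<beta> \<in> {\<beta> \<in> {c0<..<0.739} \<times> {c1<..<0.739}.
        \<bar>code_sum (fst \<beta>) (snd \<beta>) ?x - code_sum (fst \<beta>) (snd \<beta>) ?y\<bar> < r'}"
      using uv by auto
  qed
  then have "emeasure lborel ?A \<le> emeasure lborel {\<beta> \<in> {c0<..<0.739} \<times> {c1<..<0.739}.
      \<bar>code_sum (fst \<beta>) (snd \<beta>) ?x - code_sum (fst \<beta>) (snd \<beta>) ?y\<bar> < r'}"
    using sets_box_code_sum by (intro emeasure_mono) auto
  also have "\<dots> \<le> ennreal (?K * r')"
  proof (cases "x n")
    case True
    then show ?thesis using n isolated_ones c r' by (intro box_measure) auto
  next
    case False
    then show ?thesis
      using n isolated_ones c r' box_measure[of ?y ?x c0 c1 r'] by (simp add: abs_minus_commute)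
  qed
  also have "ennreal (?K * r') = ennreal (?K * r) * ?t n"
    using agree c r w by (subst ennreal_mult[symmetric]) (auto simp: r'_def)
  also have "\<dots> \<le> ennreal (?K * r) * (\<Sum>n. ?t n)"
    using sum_le_suminf[of ?t "{n}"] by (intro mult_left_mono) auto
  finally show ?thesis .
qed

text \<open>The energy method. The correlation integral at radius \<open>r\<close>, integrated over the box, is at most a
constant times \<open>r\<close>: exchange the integrals and use the bound on near coincidences. Fatou's lemma
then bounds the lower limit of the rescaled correlation integral for almost every parameter.\<close>
lemma AE_bounded_energy:
  fixes N :: "'a measure" and Y :: "'a \<Rightarrow> nat \<Rightarrow> bool" and c0 c1 :: real
  assumes fin: "finite_measure N"
    and Y [measurable]: "\<And>i. Measurable.pred N (\<lambda>\<omega>. Y \<omega> i)"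
    and isolated_ones: "AE \<omega> in N. isolated_ones (Y \<omega>)"
    and c: "0 < c0" "c0 < 1" "0 < c1" "c1 < 1"
    and finite_overlap: "(\<Sum>n. \<integral>\<^sup>+ \<omega>. emeasure N {\<tau> \<in> space N. \<forall>k<n. Y \<omega> k = Y \<tau> k}
        * ennreal (1 / wt c0 c1 (Y \<omega>) n) \<partial>N) < \<infinity>"
  shows "AE \<beta> in lborel. \<beta> \<in> {c0<..<0.739} \<times> {c1<..<0.739} \<longrightarrow>
    (\<exists>C\<ge>0. bounded_energy (distr N borel (\<lambda>\<omega>. code_sum (fst \<beta>) (snd \<beta>) (Y \<omega>))) C)"
proof -
  interpret N: finite_measure N by fact
  interpret NN: pair_sigma_finite N N ..
  interpret NN': finite_measure "N \<Otimes>\<^sub>M N" by (intro finite_measure_pair_measure fin)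
  interpret Q: pair_sigma_finite "lborel :: (real \<times> real) measure" "N \<Otimes>\<^sub>M N" ..
  define B where "B = {c0<..<0.739} \<times> {c1<..<0.739::real}"
  have Bm [measurable]: "B \<in> sets borel"
    unfolding B_def by (intro borel_open open_Times) auto
  let ?S = "\<lambda>\<beta> \<omega>. code_sum (fst \<beta>) (snd \<beta>) (Y \<omega>)"
  define E where "E k \<beta> = (\<integral>\<^sup>+ p. indicator {p. \<bar>?S \<beta> (fst p) - ?S \<beta> (snd p)\<bar> < 2 * (1 / 2 ^ k)} p \<partial>(N \<Otimes>\<^sub>M N))" for k \<beta>
  have E: "emeasure (distr N borel (?S \<beta>) \<Otimes>\<^sub>M distr N borel (?S \<beta>)) {p. \<bar>fst p - snd p\<bar> < 2 * (1 / 2 ^ k)} = E k \<beta>"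
    for k \<beta>
  proof -
    have sm [measurable]: "?S \<beta> \<in> borel_measurable N" by measurable
    have "distr N borel (?S \<beta>) \<Otimes>\<^sub>M distr N borel (?S \<beta>)
        = distr (N \<Otimes>\<^sub>M N) (borel \<Otimes>\<^sub>M borel) (\<lambda>(\<omega>, \<tau>). (?S \<beta> \<omega>, ?S \<beta> \<tau>))"
      using N.finite_measure_distr[OF sm]
      by (intro pair_measure_distr sm finite_measure.sigma_finite_measure)
    moreover have "emeasure (distr (N \<Otimes>\<^sub>M N) (borel \<Otimes>\<^sub>M borel) (\<lambda>(\<omega>, \<tau>). (?S \<beta> \<omega>, ?S \<beta> \<tau>)))
          {p. \<bar>fst p - snd p\<bar> < 2 * (1 / 2 ^ k)}
        = emeasure (N \<Otimes>\<^sub>M N) ((\<lambda>(\<omega>, \<tau>). (?S \<beta> \<omega>, ?S \<beta> \<tau>)) -` {p. \<bar>fst p - snd p\<bar> < 2 * (1 / 2 ^ k)} \<inter> space (N \<Otimes>\<^sub>M N))"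
    proof (rule emeasure_distr)
      have "{p \<in> space (borel \<Otimes>\<^sub>M borel). \<bar>fst p - snd p\<bar> < 2 * (1 / 2 ^ k)} \<in> sets (borel \<Otimes>\<^sub>M (borel :: real measure))"
        by measurable
      then show "{p :: real \<times> real. \<bar>fst p - snd p\<bar> < 2 * (1 / 2 ^ k)} \<in> sets (borel \<Otimes>\<^sub>M borel)"
        by (simp add: space_pair_measure)
    qed measurable
    ultimately have "emeasure (distr N borel (?S \<beta>) \<Otimes>\<^sub>M distr N borel (?S \<beta>)) {p. \<bar>fst p - snd p\<bar> < 2 * (1 / 2 ^ k)}
        = emeasure (N \<Otimes>\<^sub>M N) ((\<lambda>(\<omega>, \<tau>). (?S \<beta> \<omega>, ?S \<beta> \<tau>)) -` {p. \<bar>fst p - snd p\<bar> < 2 * (1 / 2 ^ k)} \<inter> space (N \<Otimes>\<^sub>M N))"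
      by (simp only:)
    also have "(\<lambda>(\<omega>, \<tau>). (?S \<beta> \<omega>, ?S \<beta> \<tau>)) -` {p. \<bar>fst p - snd p\<bar> < 2 * (1 / 2 ^ k)} \<inter> space (N \<Otimes>\<^sub>M N)
        = {p \<in> space (N \<Otimes>\<^sub>M N). \<bar>?S \<beta> (fst p) - ?S \<beta> (snd p)\<bar> < 2 * (1 / 2 ^ k)}"
      by auto
    also have "emeasure (N \<Otimes>\<^sub>M N) \<dots> = (\<integral>\<^sup>+ p. indicator \<dots> p \<partial>(N \<Otimes>\<^sub>M N))"
      by (intro nn_integral_indicator[symmetric]) measurable
    also have "\<dots> = E k \<beta>"
      unfolding E_def by (intro nn_integral_cong) (auto simp: indicator_def)
    finally show ?thesis .
  qed
  have jm [measurable]: "(\<lambda>(\<beta>, p). indicator B \<beta> * indicator {p. \<bar>?S \<beta> (fst p) - ?S \<beta> (snd p)\<bar> < 2 * (1 / 2 ^ k)} p :: ennreal)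
      \<in> borel_measurable (lborel \<Otimes>\<^sub>M (N \<Otimes>\<^sub>M N))" for k :: nat
    unfolding indicator_def by measurable
  have Em [measurable]: "E k \<in> borel_measurable borel" for k
  proof -
    have "(\<lambda>(\<beta>, p). indicator {p. \<bar>?S \<beta> (fst p) - ?S \<beta> (snd p)\<bar> < 2 * (1 / 2 ^ k)} p :: ennreal)
      \<in> borel_measurable (lborel \<Otimes>\<^sub>M (N \<Otimes>\<^sub>M N))"
      unfolding indicator_def by measurable
    from sigma_finite_measure.borel_measurable_nn_integral[OF finite_measure.sigma_finite_measure[OF finite_measure_pair_measure[OF fin fin]] this] show ?thesis by (simp add: E_def[abs_def])
  qed
  define \<kappa> where "\<kappa> p = (\<Sum>n. ennreal (of_bool (\<forall>k<n. Y (fst p) k = Y (snd p) k) / wt c0 c1 (Y (fst p)) n))" for p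
  have tm [measurable]: "(\<lambda>p. ennreal (of_bool (\<forall>k<n. Y (fst p) k = Y (snd p) k) / wt c0 c1 (Y (fst p)) n))
      \<in> borel_measurable (N \<Otimes>\<^sub>M N)" for n
    unfolding wt_def of_bool_def by measurable
  define T where "T = (\<integral>\<^sup>+ p. \<kappa> p \<partial>(N \<Otimes>\<^sub>M N))"
  have T: "T < \<infinity>"
  proof -
    have "T = (\<Sum>n. \<integral>\<^sup>+ p. ennreal (of_bool (\<forall>k<n. Y (fst p) k = Y (snd p) k) / wt c0 c1 (Y (fst p)) n) \<partial>(N \<Otimes>\<^sub>M N))"
      unfolding T_def \<kappa>_def by (intro nn_integral_suminf tm)
    also have "\<dots> = (\<Sum>n. \<integral>\<^sup>+ \<omega>. emeasure N {\<tau> \<in> space N. \<forall>k<n. Y \<omega> k = Y \<tau> k}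
        * ennreal (1 / wt c0 c1 (Y \<omega>) n) \<partial>N)"
    proof (intro suminf_cong)
      fix n
      have "(\<integral>\<^sup>+ p. ennreal (of_bool (\<forall>k<n. Y (fst p) k = Y (snd p) k) / wt c0 c1 (Y (fst p)) n) \<partial>(N \<Otimes>\<^sub>M N))
        = (\<integral>\<^sup>+ \<omega>. (\<integral>\<^sup>+ \<tau>. ennreal (of_bool (\<forall>k<n. Y \<omega> k = Y \<tau> k) / wt c0 c1 (Y \<omega>) n) \<partial>N) \<partial>N)"
        using N.nn_integral_fst[OF tm[of n]] by simp
      also have "\<dots> = (\<integral>\<^sup>+ \<omega>. emeasure N {\<tau> \<in> space N. \<forall>k<n. Y \<omega> k = Y \<tau> k} * ennreal (1 / wt c0 c1 (Y \<omega>) n) \<partial>N)"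
      proof (intro nn_integral_cong)
        fix \<omega> assume "\<omega> \<in> space N"
        have "(\<integral>\<^sup>+ \<tau>. ennreal (of_bool (\<forall>k<n. Y \<omega> k = Y \<tau> k) / wt c0 c1 (Y \<omega>) n) \<partial>N)
          = (\<integral>\<^sup>+ \<tau>. ennreal (1 / wt c0 c1 (Y \<omega>) n) * indicator {\<tau> \<in> space N. \<forall>k<n. Y \<omega> k = Y \<tau> k} \<tau> \<partial>N)"
          by (intro nn_integral_cong) (auto simp: indicator_def)
        also have "\<dots> = ennreal (1 / wt c0 c1 (Y \<omega>) n) * emeasure N {\<tau> \<in> space N. \<forall>k<n. Y \<omega> k = Y \<tau> k}"
          by (intro nn_integral_cmult_indicator) measurable
        finally show "(\<integral>\<^sup>+ \<tau>. ennreal (of_bool (\<forall>k<n. Y \<omega> k = Y \<tau> k) / wt c0 c1 (Y \<omega>) n) \<partial>N)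
          = emeasure N {\<tau> \<in> space N. \<forall>k<n. Y \<omega> k = Y \<tau> k} * ennreal (1 / wt c0 c1 (Y \<omega>) n)"
          by (simp add: mult.commute)
      qed
      finally show "(\<integral>\<^sup>+ p. ennreal (of_bool (\<forall>k<n. Y (fst p) k = Y (snd p) k) / wt c0 c1 (Y (fst p)) n) \<partial>(N \<Otimes>\<^sub>M N))
        = (\<integral>\<^sup>+ \<omega>. emeasure N {\<tau> \<in> space N. \<forall>k<n. Y \<omega> k = Y \<tau> k} * ennreal (1 / wt c0 c1 (Y \<omega>) n) \<partial>N)" .
    qed
    finally show ?thesis using finite_overlap by simp
  qed
  define K where "K = 800 / (c1 * min c0 c1 ^ 6)"
  have K: "0 < K" using c by (simp add: K_def)
  have sparse2: "AE p in N \<Otimes>\<^sub>M N. isolated_ones (Y (fst p)) \<and> isolated_ones (Y (snd p))"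
  proof (rule NN.AE_pair_measure)
    show "{p \<in> space (N \<Otimes>\<^sub>M N). isolated_ones (Y (fst p)) \<and> isolated_ones (Y (snd p))} \<in> sets (N \<Otimes>\<^sub>M N)"
      unfolding isolated_ones_def by measurable
    show "AE \<omega> in N. AE \<tau> in N. isolated_ones (Y (fst (\<omega>, \<tau>))) \<and> isolated_ones (Y (snd (\<omega>, \<tau>)))"
      using isolated_ones by eventually_elim (use isolated_ones in auto)
  qed
  have bound: "(\<integral>\<^sup>+ \<beta>. indicator B \<beta> * (2 ^ k * E k \<beta>) \<partial>lborel) \<le> ennreal (2 * K) * T" for k
  proof -
    have "(\<integral>\<^sup>+ \<beta>. indicator B \<beta> * E k \<beta> \<partial>lborel)
        = (\<integral>\<^sup>+ \<beta>. (\<integral>\<^sup>+ p. indicator B \<beta> * indicator {p. \<bar>?S \<beta> (fst p) - ?S \<beta> (snd p)\<bar> < 2 * (1 / 2 ^ k)} p \<partial>(N \<Otimes>\<^sub>M N)) \<partial>lborel)"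
      unfolding E_def
      by (intro nn_integral_cong nn_integral_cmult[symmetric]) (unfold indicator_def, measurable)
    also have "\<dots> = (\<integral>\<^sup>+ p. (\<integral>\<^sup>+ \<beta>. indicator B \<beta> * indicator {p. \<bar>?S \<beta> (fst p) - ?S \<beta> (snd p)\<bar> < 2 * (1 / 2 ^ k)} p \<partial>lborel) \<partial>(N \<Otimes>\<^sub>M N))"
      using Q.Fubini'[OF jm[of k]] by simp
    also have "\<dots> \<le> (\<integral>\<^sup>+ p. ennreal (K * (2 * (1 / 2 ^ k))) * \<kappa> p \<partial>(N \<Otimes>\<^sub>M N))"
    proof (rule nn_integral_mono_AE, use sparse2 in eventually_elim)
      fix p assume p: "isolated_ones (Y (fst p)) \<and> isolated_ones (Y (snd p))"
      have "(\<integral>\<^sup>+ \<beta>. indicator B \<beta> * indicator {p. \<bar>?S \<beta> (fst p) - ?S \<beta> (snd p)\<bar> < 2 * (1 / 2 ^ k)} p \<partial>lborel)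
        = (\<integral>\<^sup>+ \<beta>. indicator {\<beta> \<in> B. \<bar>?S \<beta> (fst p) - ?S \<beta> (snd p)\<bar> < 2 * (1 / 2 ^ k)} \<beta> \<partial>lborel)"
        by (intro nn_integral_cong) (auto simp: indicator_def)
      also have "\<dots> = emeasure lborel {\<beta> \<in> B. \<bar>?S \<beta> (fst p) - ?S \<beta> (snd p)\<bar> < 2 * (1 / 2 ^ k)}"
        unfolding B_def using sets_box_code_sum by (intro nn_integral_indicator) auto
      also have "\<dots> \<le> ennreal (K * (2 * (1 / 2 ^ k))) * \<kappa> p"
        unfolding B_def \<kappa>_def K_def using p c by (intro box_measure_le_overlap) auto
      finally show "(\<integral>\<^sup>+ \<beta>. indicator B \<beta> * indicator {p. \<bar>?S \<beta> (fst p) - ?S \<beta> (snd p)\<bar> < 2 * (1 / 2 ^ k)} p \<partial>lborel)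
        \<le> ennreal (K * (2 * (1 / 2 ^ k))) * \<kappa> p" .
    qed
    also have "\<dots> = ennreal (K * (2 * (1 / 2 ^ k))) * T"
      unfolding T_def \<kappa>_def by (intro nn_integral_cmult borel_measurable_suminf_order tm)
    finally have E_int: "(\<integral>\<^sup>+ \<beta>. indicator B \<beta> * E k \<beta> \<partial>lborel) \<le> ennreal (K * (2 * (1 / 2 ^ k))) * T" .
    have "(\<integral>\<^sup>+ \<beta>. indicator B \<beta> * (2 ^ k * E k \<beta>) \<partial>lborel)
        = (\<integral>\<^sup>+ \<beta>. ennreal (2 ^ k) * (indicator B \<beta> * E k \<beta>) \<partial>lborel)"
      by (intro nn_integral_cong) (simp add: ennreal_power[symmetric] mult.left_commute)
    also have "\<dots> = ennreal (2 ^ k) * (\<integral>\<^sup>+ \<beta>. indicator B \<beta> * E k \<beta> \<partial>lborel)"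
      by (intro nn_integral_cmult) measurable
    also have "\<dots> \<le> ennreal (2 ^ k) * (ennreal (K * (2 * (1 / 2 ^ k))) * T)"
      using E_int by (rule mult_left_mono) simp
    also have "\<dots> = ennreal (2 ^ k) * ennreal (K * (2 * (1 / 2 ^ k))) * T"
      by (simp only: mult.assoc)
    also have "ennreal (2 ^ k) * ennreal (K * (2 * (1 / 2 ^ k))) = ennreal (2 * K)"
      using K by (subst ennreal_mult[symmetric]) auto
    finally show ?thesis .
  qed
  have "(\<integral>\<^sup>+ \<beta>. liminf (\<lambda>k. indicator B \<beta> * (2 ^ k * E k \<beta>)) \<partial>lborel)
      \<le> liminf (\<lambda>k. \<integral>\<^sup>+ \<beta>. indicator B \<beta> * (2 ^ k * E k \<beta>) \<partial>lborel)"
    by (intro nn_integral_liminf) measurable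
  also have "\<dots> \<le> liminf (\<lambda>k::nat. ennreal (2 * K) * T)"
    by (intro Liminf_mono always_eventually allI bound)
  also have "\<dots> < \<infinity>" using T by (simp add: Liminf_const ennreal_mult_less_top)
  finally have "AE \<beta> in lborel. liminf (\<lambda>k. indicator B \<beta> * (2 ^ k * E k \<beta>)) \<noteq> \<infinity>"
    by (intro nn_integral_PInf_AE) auto
  then show ?thesis
  proof eventually_elim
    fix \<beta> assume fin_liminf: "liminf (\<lambda>k. indicator B \<beta> * (2 ^ k * E k \<beta>)) \<noteq> \<infinity>"
    show "\<beta> \<in> {c0<..<0.739} \<times> {c1<..<0.739} \<longrightarrow> (\<exists>C\<ge>0. bounded_energy (distr N borel (?S \<beta>)) C)"
    proof
      assume "\<beta> \<in> {c0<..<0.739} \<times> {c1<..<0.739}"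
      then have "liminf (\<lambda>k. 2 ^ k * E k \<beta>) < \<top>"
        using fin_liminf by (simp add: B_def less_top)
      then obtain m :: nat where m: "liminf (\<lambda>k. 2 ^ k * E k \<beta>) < of_nat m"
        using ennreal_Ex_less_of_nat by blast
      have "\<exists>\<^sub>F k in sequentially. E k \<beta> \<le> ennreal (real m / 2 ^ k)"
      proof (rule ccontr)
        assume "\<not> ?thesis"
        then have "\<forall>\<^sub>F k in sequentially. of_nat m \<le> 2 ^ k * E k \<beta>"
          unfolding not_frequently
        proof eventually_elim
          fix k assume "\<not> E k \<beta> \<le> ennreal (real m / 2 ^ k)"
          then have "ennreal (2 ^ k) * ennreal (real m / 2 ^ k) \<le> ennreal (2 ^ k) * E k \<beta>"
            by (intro mult_left_mono) auto
          also have "ennreal (2 ^ k) * ennreal (real m / 2 ^ k) = of_nat m"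
            by (subst ennreal_mult[symmetric]) (auto simp: ennreal_of_nat_eq_real_of_nat)
          finally show "of_nat m \<le> 2 ^ k * E k \<beta>"
            by (simp add: ennreal_power[symmetric])
        qed
        then have "of_nat m \<le> liminf (\<lambda>k. 2 ^ k * E k \<beta>)" by (rule Liminf_bounded)
        with m show False by simp
      qed
      then show "\<exists>C\<ge>0. bounded_energy (distr N borel (?S \<beta>)) C"
        unfolding bounded_energy_def E by (intro exI[of _ "real m"]) auto
    qed
  qed
qed

section \<open>Cylinder probabilities of the chain\<close>

text \<open>From state 0 the chain returns to 0 through a block \<open>0\<close> (probability \<open>p\<close>, ratio \<open>b0\<close>) or \<open>10\<close>
(probability \<open>1 - p\<close>, ratio \<open>b0 b1\<close>). The pressure sum is the mean of (probability / ratio) to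
the power \<open>s\<close> over these two blocks.\<close>
definition pressure_sum :: "real \<Rightarrow> real \<Rightarrow> real \<Rightarrow> real \<Rightarrow> real" where
  "pressure_sum p s b0 b1 = p * (p / b0) powr s + (1 - p) * ((1 - p) / (b0 * b1)) powr s"

text \<open>The given chain. In \<open>Y\<close> the state sequence is indexed from 0, \<open>Y \<omega> i\<close> meaning that the state at
time \<open>i + 1\<close> is 1.\<close>
locale hard_core_chain = prob_space M for M :: "'a measure" +
  fixes p :: real and X :: "nat \<Rightarrow> 'a \<Rightarrow> nat"
  assumes p: "0 < p" "p < 1" and chain: "markov_chain01 p M X"
begin

definition Y :: "'a \<Rightarrow> nat \<Rightarrow> bool" where
  "Y \<omega> i \<longleftrightarrow> X (Suc i) \<omega> = 1"

text \<open>The cylinder event that the state sequence begins with the word \<open>u\<close>.\<close>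
definition cyl :: "bool list \<Rightarrow> 'a set" where
  "cyl u = {\<omega> \<in> space M. \<forall>k<length u. Y \<omega> k = u ! k}"

text \<open>Transition probabilities between truth values.\<close>
definition T :: "bool \<Rightarrow> bool \<Rightarrow> real" where
  "T a b = trans_prob p (of_bool a) (of_bool b)"

lemma X_measurable: "X (Suc i) \<in> measurable M (count_space {0, 1})"
proof -
  have "\<forall>i\<ge>1. X i \<in> measurable M (count_space {0, 1})"
    using chain unfolding markov_chain01_def by (elim conjE)
  then show ?thesis by simp
qed

lemma X_cases: "\<omega> \<in> space M \<Longrightarrow> X (Suc i) \<omega> = 0 \<or> X (Suc i) \<omega> = 1"
  using measurable_space[OF X_measurable, of \<omega> i] by simp

lemma Y_measurable [measurable]: "Measurable.pred M (\<lambda>\<omega>. Y \<omega> i)"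
proof -
  have "(\<lambda>x::nat. x = 1) \<in> measurable (count_space {0, 1}) (count_space UNIV)" by simp
  from measurable_compose[OF X_measurable this] show ?thesis by (simp add: Y_def)
qed

lemma cyl_sets [measurable]: "cyl u \<in> sets M"
  unfolding cyl_def by measurable

lemma cyl_snoc_subset: "cyl (u @ [b]) \<subseteq> cyl u"
proof
  fix \<omega> assume \<omega>: "\<omega> \<in> cyl (u @ [b])"
  have "Y \<omega> k = u ! k" if "k < length u" for k
  proof -
    have "Y \<omega> k = (u @ [b]) ! k" using \<omega> that by (simp add: cyl_def)
    then show ?thesis using that by (simp add: nth_append)
  qed
  then show "\<omega> \<in> cyl u" using \<omega> by (simp add: cyl_def)
qed

text \<open>The Markov property prescribes transition probabilities only after words of positive probability; for
the other words both sides vanish.\<close>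
lemma prob_cyl_snoc:
  assumes u: "u \<noteq> []"
  shows "prob (cyl (u @ [b])) = prob (cyl u) * T (last u) b"
proof (cases "prob (cyl u) = 0")
  case True
  then have "prob (cyl (u @ [b])) \<le> 0"
    using finite_measure_mono[OF cyl_snoc_subset[of u b]] by simp
  then show ?thesis using True by (simp add: measure_le_0_iff)
next
  case False
  define n where "n = length u"
  have n: "1 \<le> n" using u by (cases u) (auto simp: n_def)
  define x where "x i = (of_bool (u ! (i - 1)) :: nat)" for i
  have Xx: "X (Suc k) \<omega> = of_bool v \<longleftrightarrow> Y \<omega> k = v" if "\<omega> \<in> space M" for \<omega> k v
    using X_cases[OF that, of k] by (cases v) (auto simp: Y_def)
  have ev: "(\<forall>i\<in>{1..n}. X i \<omega> = x i) \<longleftrightarrow> (\<forall>k<n. Y \<omega> k = u ! k)" if "\<omega> \<in> space M" for \<omega>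
  proof -
    have "(\<forall>i\<in>{1..n}. X i \<omega> = x i) \<longleftrightarrow> (\<forall>k<n. X (Suc k) \<omega> = of_bool (u ! k))"
    proof (intro iffI ballI allI impI)
      fix i assume "\<forall>k<n. X (Suc k) \<omega> = of_bool (u ! k)" "i \<in> {1..n}"
      then show "X i \<omega> = x i" by (cases i) (auto simp: x_def)
    next
      fix k assume *: "\<forall>i\<in>{1..n}. X i \<omega> = x i" and "k < n"
      then have "X (Suc k) \<omega> = x (Suc k)" by (intro bspec[OF *]) auto
      then show "X (Suc k) \<omega> = of_bool (u ! k)" by (simp add: x_def)
    qed
    then show ?thesis using Xx[OF that] by simp
  qed
  have c1: "{\<omega> \<in> space M. \<forall>i\<in>{1..n}. X i \<omega> = x i} = cyl u"
    unfolding cyl_def using ev by (auto simp: n_def)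
  have c2: "{\<omega> \<in> space M. X (Suc n) \<omega> = of_bool b \<and> (\<forall>i\<in>{1..n}. X i \<omega> = x i)} = cyl (u @ [b])"
  proof -
    have "(X (Suc n) \<omega> = of_bool b \<and> (\<forall>i\<in>{1..n}. X i \<omega> = x i)) \<longleftrightarrow>
        (\<forall>k<length (u @ [b]). Y \<omega> k = (u @ [b]) ! k)" if "\<omega> \<in> space M" for \<omega>
      using ev[OF that] Xx[OF that, of n b]
      by (auto simp: n_def nth_append less_Suc_eq)
    then show ?thesis unfolding cyl_def by blast
  qed
  have "x \<in> {1..n} \<rightarrow> {0, 1}" by (auto simp: x_def)
  moreover have "(of_bool b :: nat) \<in> {0, 1}" by auto
  moreover have "0 < prob {\<omega> \<in> space M. \<forall>i\<in>{1..n}. X i \<omega> = x i}"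
    unfolding c1 using False by (simp add: zero_less_measure_iff)
  ultimately have "\<P>(\<omega> in M. X (Suc n) \<omega> = of_bool b \<bar> \<forall>i\<in>{1..n}. X i \<omega> = x i)
      = trans_prob p (x n) (of_bool b)"
    using chain n unfolding markov_chain01_def by blast
  moreover have "x n = of_bool (last u)"
    using u by (simp add: x_def n_def last_conv_nth)
  ultimately have "prob (cyl (u @ [b])) / prob (cyl u) = T (last u) b"
    unfolding cond_prob_def c1 c2 T_def by (simp only:)
  then show ?thesis
    using False by (simp add: divide_eq_eq mult.commute)
qed

text \<open>The word formed by the first \<open>n\<close> states.\<close>
definition word :: "'a \<Rightarrow> nat \<Rightarrow> bool list" where
  "word \<omega> n = map (Y \<omega>) [0..<n]"

lemma length_word [simp]: "length (word \<omega> n) = n"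
  by (simp add: word_def)

lemma word_nth: "k < n \<Longrightarrow> word \<omega> n ! k = Y \<omega> k"
  by (simp add: word_def)

lemma in_cyl_iff: "\<omega> \<in> cyl u \<longleftrightarrow> \<omega> \<in> space M \<and> word \<omega> (length u) = u"
proof -
  have "(\<forall>k<length u. Y \<omega> k = u ! k) \<longleftrightarrow> word \<omega> (length u) = u"
  proof
    assume "\<forall>k<length u. Y \<omega> k = u ! k"
    then show "word \<omega> (length u) = u"
      by (intro nth_equalityI) (simp_all add: word_nth)
  next
    assume "word \<omega> (length u) = u"
    then show "\<forall>k<length u. Y \<omega> k = u ! k"
      by (metis word_nth)
  qed
  then show ?thesis unfolding cyl_def by blast
qed

lemma cyl_word: "cyl (word \<omega> n) = {\<tau> \<in> space M. \<forall>k<n. Y \<omega> k = Y \<tau> k}"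
proof -
  have "(\<forall>k<n. Y \<tau> k = word \<omega> n ! k) \<longleftrightarrow> (\<forall>k<n. Y \<omega> k = Y \<tau> k)" for \<tau>
    by (metis word_nth)
  then show ?thesis by (simp add: cyl_def)
qed

lemma finite_words: "finite {u :: bool list. length u = n}"
  using finite_lists_length_eq[of "UNIV :: bool set" n] by simp

lemma words_Suc:
  fixes f :: "bool list \<Rightarrow> real"
  shows "(\<Sum>u | length u = Suc n. f u) = (\<Sum>u | length u = n. f (u @ [False]) + f (u @ [True]))"
proof -
  have eq: "{u :: bool list. length u = Suc n} = (\<lambda>(u, b). u @ [b]) ` ({u. length u = n} \<times> UNIV)"
  proof safe
    fix u :: "bool list" assume "length u = Suc n"
    then have "u = (\<lambda>(u, b). u @ [b]) (butlast u, last u)" "length (butlast u) = n"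
      by (auto intro!: append_butlast_last_id[symmetric])
    then show "u \<in> (\<lambda>(u, b). u @ [b]) ` ({u. length u = n} \<times> UNIV)" by blast
  qed simp
  have "(\<Sum>u | length u = Suc n. f u) = (\<Sum>(u, b)\<in>{u. length u = n} \<times> UNIV. f (u @ [b]))"
    unfolding eq by (subst sum.reindex) (auto simp: inj_on_def case_prod_beta')
  also have "\<dots> = (\<Sum>u | length u = n. \<Sum>b\<in>UNIV. f (u @ [b]))"
    by (rule sum.cartesian_product[symmetric])
  finally show ?thesis by (simp add: UNIV_bool)
qed

lemma AE_isolated_ones: "AE \<omega> in M. isolated_ones (Y \<omega>)"
proof -
  have null: "AE \<omega> in M. \<omega> \<notin> cyl (u @ [True])" if u: "u \<noteq> []" "last u" for u
  proof -
    have "prob (cyl (u @ [True])) = 0"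
      using prob_cyl_snoc[OF u(1), of True] u by (simp add: T_def trans_prob_def)
    then have "cyl (u @ [True]) \<in> null_sets M"
      by (simp add: null_sets_def emeasure_eq_measure)
    then show ?thesis by (rule AE_not_in)
  qed
  have "AE \<omega> in M. \<forall>u\<in>{u. u \<noteq> [] \<and> last u}. \<omega> \<notin> cyl (u @ [True])"
    using null by (intro AE_ball_countable[THEN iffD2]) auto
  then show ?thesis
    using AE_space
  proof eventually_elim
    fix \<omega> assume *: "\<forall>u\<in>{u. u \<noteq> [] \<and> last u}. \<omega> \<notin> cyl (u @ [True])" "\<omega> \<in> space M"
    show "isolated_ones (Y \<omega>)"
      unfolding isolated_ones_def
    proof (intro allI notI)
      fix i assume Y: "Y \<omega> i \<and> Y \<omega> (Suc i)"
      have "word \<omega> (Suc i) @ [True] = word \<omega> (Suc (Suc i))" "word \<omega> (Suc i) \<noteq> []" "last (word \<omega> (Suc i))"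
        using Y by (auto simp: word_def)
      with * show False by (auto simp: in_cyl_iff)
    qed
  qed
qed

text \<open>Probability of the cylinder of length \<open>n\<close> around \<open>\<omega>\<close>, divided by its contraction ratio. The
energy method requires the integrals of \<open>W c0 c1 n\<close> to be summable over \<open>n\<close>.\<close>
definition W :: "real \<Rightarrow> real \<Rightarrow> nat \<Rightarrow> 'a \<Rightarrow> real" where
  "W c0 c1 n \<omega> = prob {\<tau> \<in> space M. \<forall>k<n. Y \<omega> k = Y \<tau> k} / wt c0 c1 (Y \<omega>) n"

text \<open>The same quotient as a function of the word.\<close>
definition word_ratio :: "real \<Rightarrow> real \<Rightarrow> bool list \<Rightarrow> real" where
  "word_ratio c0 c1 u = prob (cyl u) / wt c0 c1 (\<lambda>k. u ! k) (length u)"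

lemma W_eq: "W c0 c1 n \<omega> = word_ratio c0 c1 (word \<omega> n)"
proof -
  have "wt c0 c1 (Y \<omega>) n = wt c0 c1 (\<lambda>k. word \<omega> n ! k) n"
    by (intro wt_cong) (simp add: word_def)
  then show ?thesis by (simp add: W_def word_ratio_def cyl_word)
qed

lemma word_ratio_nonneg: "0 < c0 \<Longrightarrow> 0 < c1 \<Longrightarrow> 0 \<le> word_ratio c0 c1 u"
  using wt_pos[of c0 c1 "\<lambda>k. u ! k" "length u"] by (simp add: word_ratio_def)

lemma word_ratio_snoc:
  assumes "u \<noteq> []"
  shows "word_ratio c0 c1 (u @ [b]) = word_ratio c0 c1 u * (T (last u) b / (if b then c1 else c0))"
proof -
  have "wt c0 c1 (\<lambda>k. (u @ [b]) ! k) (length u) = wt c0 c1 (\<lambda>k. u ! k) (length u)"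
    by (intro wt_cong) (simp add: nth_append)
  then show ?thesis
    by (simp add: word_ratio_def prob_cyl_snoc[OF assms] wt_Suc nth_append)
qed

lemma word_function_as_sum:
  fixes f :: "bool list \<Rightarrow> real"
  assumes "\<omega> \<in> space M"
  shows "f (word \<omega> n) = (\<Sum>u | length u = n. f u * indicator (cyl u) \<omega>)"
proof -
  have "(\<Sum>u | length u = n. f u * indicator (cyl u) \<omega>) = (\<Sum>u\<in>{word \<omega> n}. f u * indicator (cyl u) \<omega>)"
    using finite_words by (intro sum.mono_neutral_right) (auto simp: in_cyl_iff indicator_def)
  then show ?thesis using assms by (simp add: in_cyl_iff)
qed

lemma W_measurable [measurable]: "W c0 c1 n \<in> borel_measurable M"
proof -
  have "W c0 c1 n \<in> borel_measurable M \<longleftrightarrow>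
      (\<lambda>\<omega>. \<Sum>u | length u = n. word_ratio c0 c1 u * indicator (cyl u) \<omega>) \<in> borel_measurable M"
    unfolding W_eq[abs_def] using word_function_as_sum by (intro measurable_cong) auto
  then show ?thesis by simp
qed

lemma W_nonneg: "0 < c0 \<Longrightarrow> 0 < c1 \<Longrightarrow> 0 \<le> W c0 c1 n \<omega>"
  by (simp add: W_eq word_ratio_nonneg)

lemma nn_integral_W_powr:
  assumes "0 < c0" "0 < c1"
  shows "(\<integral>\<^sup>+ \<omega>. ennreal (W c0 c1 n \<omega> powr s) \<partial>M)
    = ennreal (\<Sum>u | length u = n. prob (cyl u) * word_ratio c0 c1 u powr s)"
proof -
  have "(\<integral>\<^sup>+ \<omega>. ennreal (W c0 c1 n \<omega> powr s) \<partial>M)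
      = (\<integral>\<^sup>+ \<omega>. (\<Sum>u | length u = n. ennreal (word_ratio c0 c1 u powr s) * indicator (cyl u) \<omega>) \<partial>M)"
  proof (intro nn_integral_cong)
    fix \<omega> assume "\<omega> \<in> space M"
    then have "W c0 c1 n \<omega> powr s = (\<Sum>u | length u = n. word_ratio c0 c1 u powr s * indicator (cyl u) \<omega>)"
      unfolding W_eq by (rule word_function_as_sum)
    then show "ennreal (W c0 c1 n \<omega> powr s)
        = (\<Sum>u | length u = n. ennreal (word_ratio c0 c1 u powr s) * indicator (cyl u) \<omega>)"
      by (simp add: sum_ennreal[symmetric] ennreal_mult ennreal_indicator)
  qed
  also have "\<dots> = (\<Sum>u | length u = n. \<integral>\<^sup>+ \<omega>. ennreal (word_ratio c0 c1 u powr s) * indicator (cyl u) \<omega> \<partial>M)"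
    by (intro nn_integral_sum) measurable
  also have "\<dots> = (\<Sum>u | length u = n. ennreal (prob (cyl u) * word_ratio c0 c1 u powr s))"
  proof (intro sum.cong refl)
    fix u :: "bool list"
    have "(\<integral>\<^sup>+ \<omega>. ennreal (word_ratio c0 c1 u powr s) * indicator (cyl u) \<omega> \<partial>M)
        = ennreal (word_ratio c0 c1 u powr s) * ennreal (prob (cyl u))"
      by (subst nn_integral_cmult_indicator) (auto simp: emeasure_eq_measure)
    also have "\<dots> = ennreal (prob (cyl u) * word_ratio c0 c1 u powr s)"
      by (subst ennreal_mult[symmetric]) (auto simp: mult.commute)
    finally show "(\<integral>\<^sup>+ \<omega>. ennreal (word_ratio c0 c1 u powr s) * indicator (cyl u) \<omega> \<partial>M)
        = ennreal (prob (cyl u) * word_ratio c0 c1 u powr s)" .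
  qed
  also have "\<dots> = ennreal (\<Sum>u | length u = n. prob (cyl u) * word_ratio c0 c1 u powr s)"
    by (intro sum_ennreal) auto
  finally show ?thesis .
qed

text \<open>The weighted \<open>s\<close>-moments \<open>V n\<close> decay geometrically, because the matrix with entries
\<open>T a b (T a b / c\<^sub>b)\<^sup>s\<close>, where \<open>c\<^sub>b\<close> is \<open>c0\<close> or \<open>c1\<close>, maps the positive vector \<open>v\<close> to at most
\<open>l v\<close> with \<open>l < 1\<close>.\<close>
lemma summable_moments:
  assumes c: "0 < c0" "c0 < 1" "0 < c1" "c1 < 1" and s: "0 < s"
    and pressure: "pressure_sum p s c0 c1 < 1"
  shows "(\<Sum>n. \<integral>\<^sup>+ \<omega>. ennreal (W c0 c1 n \<omega> powr s) \<partial>M) < \<infinity>"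
proof -
  define A where "A = p * (p / c0) powr s"
  define B where "B = (1 - p) * ((1 - p) / (c0 * c1)) powr s"
  \<comment> \<open>Any \<open>l < 1\<close> with \<open>A + B / l \<le> l\<close> serves; \<open>l\<^sup>2 = A + B\<close> is enough because \<open>A \<le> A / l\<close>.\<close>
  define l where "l = sqrt (A + B)"
  have AB: "0 < A" "0 < B" "A + B < 1"
    using p c pressure by (auto simp: A_def B_def pressure_sum_def)
  have l: "0 < l" "l < 1" "l * l = A + B"
    using AB by (auto simp: l_def real_less_lsqrt)
  define v where "v b = (if b then (1 / c0) powr s / l else 1)" for b
  have v: "1 \<le> v b" for b
  proof -
    have "1 \<le> (1 / c0) powr s" using c s by (intro ge_one_powr_ge_zero) auto
    then show ?thesis using l by (simp add: v_def field_simps)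
  qed
  have T_nonneg: "0 \<le> T a b" for a b
    using p by (simp add: T_def trans_prob_def)
  have step: "T a False * (T a False / c0) powr s * v False + T a True * (T a True / c1) powr s * v True \<le> l * v a" for a
  proof (cases a)
    case True
    then show ?thesis using l by (simp add: T_def trans_prob_def v_def)
  next
    case False
    have "((1 - p) / c1) powr s * (1 / c0) powr s = ((1 - p) / (c0 * c1)) powr s"
      using p c by (subst powr_mult[symmetric]) (auto simp: mult.commute)
    then have "T a False * (T a False / c0) powr s * v False + T a True * (T a True / c1) powr s * v True = A + B / l"
      using False by (simp add: T_def trans_prob_def v_def A_def B_def mult.assoc)
    also have "\<dots> \<le> A / l + B / l"
      using AB l mult_left_le[of l A] by (simp add: le_divide_eq)
    also have "\<dots> = l" using l by (simp add: add_divide_distrib[symmetric] field_simps)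
    finally show ?thesis using False by (simp add: v_def)
  qed
  define V where "V n = (\<Sum>u | length u = n. prob (cyl u) * word_ratio c0 c1 u powr s * v (last u))" for n
  have V_step: "V (Suc n) \<le> l * V n" if "1 \<le> n" for n
  proof -
    have "V (Suc n) = (\<Sum>u | length u = n. prob (cyl u) * word_ratio c0 c1 u powr s *
        (T (last u) False * (T (last u) False / c0) powr s * v False + T (last u) True * (T (last u) True / c1) powr s * v True))"
      unfolding V_def words_Suc
    proof (intro sum.cong refl)
      fix u :: "bool list" assume "u \<in> {u. length u = n}"
      then have u: "u \<noteq> []" using that by auto
      have mult: "prob (cyl (u @ [b])) * word_ratio c0 c1 (u @ [b]) powr s * v (last (u @ [b]))
          = prob (cyl u) * word_ratio c0 c1 u powr s
            * (T (last u) b * (T (last u) b / (if b then c1 else c0)) powr s * v b)" for b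
      proof -
        have rearrange: "(q * t) * (r * w) * z = q * r * (t * w * z)" for q t r w z :: real
          by simp
        have eq: "(word_ratio c0 c1 u * (T (last u) b / (if b then c1 else c0))) powr s
            = word_ratio c0 c1 u powr s * (T (last u) b / (if b then c1 else c0)) powr s"
          by (rule powr_mult)
        show ?thesis
          unfolding prob_cyl_snoc[OF u] word_ratio_snoc[OF u] last_snoc eq by (rule rearrange)
      qed
      show "prob (cyl (u @ [False])) * word_ratio c0 c1 (u @ [False]) powr s * v (last (u @ [False])) +
          prob (cyl (u @ [True])) * word_ratio c0 c1 (u @ [True]) powr s * v (last (u @ [True]))
        = prob (cyl u) * word_ratio c0 c1 u powr s *
          (T (last u) False * (T (last u) False / c0) powr s * v False + T (last u) True * (T (last u) True / c1) powr s * v True)"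
        using mult[of False] mult[of True] by (simp only: distrib_left if_True if_False)
    qed
    also have "\<dots> \<le> (\<Sum>u | length u = n. prob (cyl u) * word_ratio c0 c1 u powr s * (l * v (last u)))"
      by (intro sum_mono mult_left_mono step) auto
    also have "\<dots> = l * V n" by (simp add: V_def sum_distrib_left algebra_simps)
    finally show ?thesis .
  qed
  have V_le: "V (Suc n) \<le> l ^ n * V 1" for n
  proof (induction n)
    case (Suc n)
    have "V (Suc (Suc n)) \<le> l * V (Suc n)" by (rule V_step) simp
    also have "\<dots> \<le> l * (l ^ n * V 1)" using Suc l by (intro mult_left_mono) auto
    finally show ?case by (simp add: ac_simps)
  qed simp
  let ?J = "\<lambda>n. \<integral>\<^sup>+ \<omega>. ennreal (W c0 c1 n \<omega> powr s) \<partial>M"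
  have J_le: "?J n \<le> ennreal (V n)" for n
  proof -
    have "(\<Sum>u | length u = n. prob (cyl u) * word_ratio c0 c1 u powr s) \<le> V n"
      unfolding V_def
    proof (rule sum_mono)
      fix u :: "bool list"
      show "prob (cyl u) * word_ratio c0 c1 u powr s \<le> prob (cyl u) * word_ratio c0 c1 u powr s * v (last u)"
        using mult_left_mono[OF v[of "last u"], of "prob (cyl u) * word_ratio c0 c1 u powr s"] by simp
    qed
    then show ?thesis using nn_integral_W_powr[of c0 c1 n s] c by (simp add: ennreal_leI)
  qed
  have V1: "0 \<le> V 1"
    unfolding V_def using order_trans[OF zero_le_one v] by (intro sum_nonneg mult_nonneg_nonneg) auto
  \<comment> \<open>The empty word has no last state, so the recursion starts at length 1.\<close>
  have "(\<Sum>n. ?J n) = (\<Sum>n. ?J (n + 1)) + (\<Sum>n<1. ?J n)"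
    by (rule suminf_offset) simp
  also have "\<dots> \<le> (\<Sum>n. ennreal (l ^ n * V 1)) + ennreal (V 0)"
  proof (rule add_mono)
    show "(\<Sum>n. ?J (n + 1)) \<le> (\<Sum>n. ennreal (l ^ n * V 1))"
    proof (rule suminf_le)
      fix n
      have "ennreal (V (Suc n)) \<le> ennreal (l ^ n * V 1)" by (intro ennreal_leI V_le)
      then show "?J (n + 1) \<le> ennreal (l ^ n * V 1)"
        using J_le[of "n + 1"] by simp
    qed auto
  qed (use J_le[of 0] in simp)
  also have "\<dots> < \<infinity>"
  proof -
    have sm: "summable (\<lambda>n. l ^ n * V 1)"
      using l by (intro summable_mult2 summable_geometric) auto
    have "(\<Sum>n. ennreal (l ^ n * V 1)) = ennreal (\<Sum>n. l ^ n * V 1)"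
      using l V1 by (intro suminf_ennreal2 sm) auto
    then show ?thesis by simp
  qed
  finally show ?thesis .
qed

end

section \<open>Good parameters in a box\<close>

context hard_core_chain
begin

lemma geometric_sum_eq:
  assumes \<omega>: "\<omega> \<in> space M"
  shows "geometric_sum b0 b1 X \<omega> = code_sum b0 b1 (Y \<omega>)"
proof -
  have X: "X (Suc i) \<omega> = of_bool (Y \<omega> i)" for i
    using X_cases[OF \<omega>, of i] by (auto simp: Y_def)
  have wt: "partial_count X n \<omega> \<le> n \<and>
      b1 ^ partial_count X n \<omega> * b0 ^ (n - partial_count X n \<omega>) = wt b0 b1 (Y \<omega>) n" for n
  proof (induction n)
    case 0
    then show ?case by (simp add: partial_count_def)
  next
    case (Suc n)
    have "partial_count X (Suc n) \<omega> = partial_count X n \<omega> + of_bool (Y \<omega> n)"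
      by (simp add: partial_count_def X)
    with Suc show ?case by (cases "Y \<omega> n") (auto simp: wt_Suc Suc_diff_le)
  qed
  show ?thesis
    unfolding geometric_sum_def code_sum_def Let_def X
    using wt[of "Suc _"] by (intro suminf_cong) (simp add: mult.assoc)
qed

lemma markov_geometric_measure_eq:
  "markov_geometric_measure b0 b1 M X = distr M borel (\<lambda>\<omega>. code_sum b0 b1 (Y \<omega>))"
  unfolding markov_geometric_measure_def by (intro distr_cong refl geometric_sum_eq)

lemma overlap_eq_W:
  assumes "0 < c0" "0 < c1"
  shows "emeasure M {\<tau> \<in> space M. \<forall>k<n. Y \<omega> k = Y \<tau> k} * ennreal (1 / wt c0 c1 (Y \<omega>) n) = ennreal (W c0 c1 n \<omega>)"
  using wt_pos[OF assms, of "Y \<omega>" n]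
  unfolding W_def emeasure_eq_measure by (subst ennreal_mult[symmetric]) auto

text \<open>For \<open>s = 1\<close> the moments are the integrals of \<open>W c0 c1 n\<close> themselves, and the energy method applies to
the whole probability space.\<close>
lemma AE_box_L2_density:
  assumes c: "0 < c0" "c0 < 1" "0 < c1" "c1 < 1" and pressure: "pressure_sum p 1 c0 c1 < 1"
  shows "AE \<beta> in lborel. \<beta> \<in> {c0<..<0.739} \<times> {c1<..<0.739} \<longrightarrow>
    has_L2_density (markov_geometric_measure (fst \<beta>) (snd \<beta>) M X)"
proof -
  have "(\<Sum>n. \<integral>\<^sup>+ \<omega>. emeasure M {\<tau> \<in> space M. \<forall>k<n. Y \<omega> k = Y \<tau> k}
      * ennreal (1 / wt c0 c1 (Y \<omega>) n) \<partial>M) = (\<Sum>n. \<integral>\<^sup>+ \<omega>. ennreal (W c0 c1 n \<omega> powr 1) \<partial>M)"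
    using W_nonneg[of c0 c1] c by (simp add: overlap_eq_W)
  also have "\<dots> < \<infinity>"
    using c pressure by (intro summable_moments) auto
  finally have "AE \<beta> in lborel. \<beta> \<in> {c0<..<0.739} \<times> {c1<..<0.739} \<longrightarrow>
      (\<exists>C\<ge>0. bounded_energy (distr M borel (\<lambda>\<omega>. code_sum (fst \<beta>) (snd \<beta>) (Y \<omega>))) C)"
    by (intro AE_bounded_energy finite_measure_axioms Y_measurable AE_isolated_ones c)
  then show ?thesis
  proof eventually_elim
    fix \<beta> :: "real \<times> real"
    assume *: "\<beta> \<in> {c0<..<0.739} \<times> {c1<..<0.739} \<longrightarrow>
      (\<exists>C\<ge>0. bounded_energy (distr M borel (\<lambda>\<omega>. code_sum (fst \<beta>) (snd \<beta>) (Y \<omega>))) C)"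
    have "finite_measure (distr M borel (\<lambda>\<omega>. code_sum (fst \<beta>) (snd \<beta>) (Y \<omega>)))"
      by (intro finite_measure_distr) measurable
    then show "\<beta> \<in> {c0<..<0.739} \<times> {c1<..<0.739} \<longrightarrow>
        has_L2_density (markov_geometric_measure (fst \<beta>) (snd \<beta>) M X)"
      using * absolutely_continuous_of_energy square_integrable_density_of_energy
      unfolding has_L2_density_def markov_geometric_measure_eq by fastforce
  qed
qed

text \<open>The event on which the quotients \<open>W c0 c1 n\<close> are bounded by \<open>K\<close> along the whole path.\<close>
definition tame :: "real \<Rightarrow> real \<Rightarrow> nat \<Rightarrow> 'a set" where
  "tame c0 c1 K = {\<omega> \<in> space M. \<forall>n. W c0 c1 n \<omega> \<le> real K}"

lemma tame_sets [measurable]: "tame c0 c1 K \<in> sets M"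
  unfolding tame_def by measurable

lemma AE_tame:
  assumes c: "0 < c0" "c0 < 1" "0 < c1" "c1 < 1" and s: "0 < s"
    and pressure: "pressure_sum p s c0 c1 < 1"
  shows "AE \<omega> in M. \<exists>K. \<omega> \<in> tame c0 c1 K"
proof -
  have "(\<integral>\<^sup>+ \<omega>. (\<Sum>n. ennreal (W c0 c1 n \<omega> powr s)) \<partial>M) = (\<Sum>n. \<integral>\<^sup>+ \<omega>. ennreal (W c0 c1 n \<omega> powr s) \<partial>M)"
    by (intro nn_integral_suminf) measurable
  also have "\<dots> < \<infinity>" by (intro summable_moments c s pressure)
  finally have "AE \<omega> in M. (\<Sum>n. ennreal (W c0 c1 n \<omega> powr s)) \<noteq> \<infinity>"
    by (intro nn_integral_PInf_AE) auto
  then show ?thesis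
    using AE_space
  proof eventually_elim
    fix \<omega> assume "(\<Sum>n. ennreal (W c0 c1 n \<omega> powr s)) \<noteq> \<infinity>" and \<omega>: "\<omega> \<in> space M"
    then obtain m :: nat where m: "(\<Sum>n. ennreal (W c0 c1 n \<omega> powr s)) < of_nat m"
      using ennreal_Ex_less_of_nat less_top by (metis infinity_ennreal_def)
    obtain K :: nat where K: "real m powr (1 / s) \<le> real K" using real_arch_simple by blast
    have "W c0 c1 n \<omega> \<le> real K" for n
    proof -
      have "ennreal (W c0 c1 n \<omega> powr s) \<le> (\<Sum>n. ennreal (W c0 c1 n \<omega> powr s))"
      proof -
        have "(\<Sum>n\<in>{n}. ennreal (W c0 c1 n \<omega> powr s)) \<le> (\<Sum>n. ennreal (W c0 c1 n \<omega> powr s))"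
          by (rule sum_le_suminf) auto
        then show ?thesis
          by (simp only: sum.insert sum.empty finite.emptyI empty_iff not_False_eq_True add_0_right)
      qed
      also have "\<dots> \<le> ennreal (real m)" using m by (simp add: ennreal_of_nat_eq_real_of_nat)
      finally have "W c0 c1 n \<omega> powr s \<le> real m" by (simp add: ennreal_le_iff)
      then have "(W c0 c1 n \<omega> powr s) powr (1 / s) \<le> real m powr (1 / s)"
        using s by (intro powr_mono2) auto
      moreover have "(W c0 c1 n \<omega> powr s) powr (1 / s) = W c0 c1 n \<omega>"
        using s W_nonneg[of c0 c1 n \<omega>] c by (simp add: powr_powr)
      ultimately show ?thesis using K by linarith
    qed
    then show "\<exists>K. \<omega> \<in> tame c0 c1 K" using \<omega> by (auto simp: tame_def)
  qed
qed

text \<open>On \<open>tame c0 c1 K\<close> the bound \<open>W \<le> K\<^bsup>1-s\<^esup> W\<^sup>s\<close> holds, so the energy method applies to the probability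
restricted to that event. The image measures of these restrictions are absolutely continuous, and the
events exhaust the space up to a null set.\<close>
lemma AE_box_absolutely_continuous:
  assumes c: "0 < c0" "c0 < 1" "0 < c1" "c1 < 1" and s: "0 < s" "s \<le> 1"
    and pressure: "pressure_sum p s c0 c1 < 1"
  shows "AE \<beta> in lborel. \<beta> \<in> {c0<..<0.739} \<times> {c1<..<0.739} \<longrightarrow>
    absolutely_continuous lborel (markov_geometric_measure (fst \<beta>) (snd \<beta>) M X)"
proof -
  define N where "N K = density M (indicator (tame c0 c1 K))" for K
  have N_sets [measurable_cong, simp]: "sets (N K) = sets M" and N_space [simp]: "space (N K) = space M" for K
    by (auto simp: N_def)
  have N_emeasure: "emeasure (N K) A = emeasure M (tame c0 c1 K \<inter> A)" if "A \<in> sets M" for K A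
    using that by (simp add: N_def emeasure_density indicator_inter_arith[symmetric] del: nn_integral_indicator)
      (simp add: sets.Int)
  have N_finite: "finite_measure (N K)" for K
    by (intro finite_measureI) (simp add: N_emeasure emeasure_eq_measure)
  have "AE \<beta> in lborel. \<beta> \<in> {c0<..<0.739} \<times> {c1<..<0.739} \<longrightarrow>
      (\<exists>C\<ge>0. bounded_energy (distr (N K) borel (\<lambda>\<omega>. code_sum (fst \<beta>) (snd \<beta>) (Y \<omega>))) C)" for K
  proof (rule AE_bounded_energy[OF N_finite _ _ c])
    show "Measurable.pred (N K) (\<lambda>\<omega>. Y \<omega> i)" for i by measurable
    show "AE \<omega> in N K. isolated_ones (Y \<omega>)"
      unfolding N_def using AE_isolated_ones by (subst AE_density) auto
    have "(\<Sum>n. \<integral>\<^sup>+ \<omega>. emeasure (N K) {\<tau> \<in> space (N K). \<forall>k<n. Y \<omega> k = Y \<tau> k} * ennreal (1 / wt c0 c1 (Y \<omega>) n) \<partial>N K)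
        \<le> (\<Sum>n. ennreal (real K powr (1 - s)) * (\<integral>\<^sup>+ \<omega>. ennreal (W c0 c1 n \<omega> powr s) \<partial>M))"
    proof (intro suminf_le summableI)
      fix n
      have "(\<integral>\<^sup>+ \<omega>. emeasure (N K) {\<tau> \<in> space (N K). \<forall>k<n. Y \<omega> k = Y \<tau> k} * ennreal (1 / wt c0 c1 (Y \<omega>) n) \<partial>N K)
          \<le> (\<integral>\<^sup>+ \<omega>. ennreal (W c0 c1 n \<omega>) \<partial>N K)"
      proof (intro nn_integral_mono)
        fix \<omega>
        have "{\<tau> \<in> space M. \<forall>k<n. Y \<omega> k = Y \<tau> k} \<in> sets M"
          using cyl_sets[of "word \<omega> n"] by (simp add: cyl_word)
        then have "emeasure (N K) {\<tau> \<in> space M. \<forall>k<n. Y \<omega> k = Y \<tau> k} \<le> emeasure M {\<tau> \<in> space M. \<forall>k<n. Y \<omega> k = Y \<tau> k}"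
          by (simp add: N_emeasure) (intro emeasure_mono; auto)
        then show "emeasure (N K) {\<tau> \<in> space (N K). \<forall>k<n. Y \<omega> k = Y \<tau> k} * ennreal (1 / wt c0 c1 (Y \<omega>) n)
            \<le> ennreal (W c0 c1 n \<omega>)"
          unfolding overlap_eq_W[OF c(1,3), symmetric] N_space by (intro mult_right_mono) auto
      qed
      also have "\<dots> = (\<integral>\<^sup>+ \<omega>. indicator (tame c0 c1 K) \<omega> * ennreal (W c0 c1 n \<omega>) \<partial>M)"
        unfolding N_def by (intro nn_integral_density) measurable
      also have "\<dots> \<le> (\<integral>\<^sup>+ \<omega>. ennreal (real K powr (1 - s)) * ennreal (W c0 c1 n \<omega> powr s) \<partial>M)"
      proof (intro nn_integral_mono)
        fix \<omega>
        show "indicator (tame c0 c1 K) \<omega> * ennreal (W c0 c1 n \<omega>)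
            \<le> ennreal (real K powr (1 - s)) * ennreal (W c0 c1 n \<omega> powr s)"
        proof (cases "\<omega> \<in> tame c0 c1 K")
          case True
          then have le: "W c0 c1 n \<omega> \<le> real K" by (simp add: tame_def)
          have nn: "0 \<le> W c0 c1 n \<omega>" using W_nonneg c by simp
          have "W c0 c1 n \<omega> = W c0 c1 n \<omega> powr (1 - s) * W c0 c1 n \<omega> powr s"
            using nn by (cases "W c0 c1 n \<omega> = 0") (simp_all add: powr_add[symmetric])
          also have "\<dots> \<le> real K powr (1 - s) * W c0 c1 n \<omega> powr s"
            using nn le s by (intro mult_right_mono powr_mono2) auto
          finally show ?thesis
            using True by (simp add: ennreal_mult[symmetric] ennreal_leI)
        qed simp
      qed
      also have "\<dots> = ennreal (real K powr (1 - s)) * (\<integral>\<^sup>+ \<omega>. ennreal (W c0 c1 n \<omega> powr s) \<partial>M)"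
        by (intro nn_integral_cmult) measurable
      finally show "(\<integral>\<^sup>+ \<omega>. emeasure (N K) {\<tau> \<in> space (N K). \<forall>k<n. Y \<omega> k = Y \<tau> k} * ennreal (1 / wt c0 c1 (Y \<omega>) n) \<partial>N K)
          \<le> ennreal (real K powr (1 - s)) * (\<integral>\<^sup>+ \<omega>. ennreal (W c0 c1 n \<omega> powr s) \<partial>M)" .
    qed
    also have "\<dots> = ennreal (real K powr (1 - s)) * (\<Sum>n. \<integral>\<^sup>+ \<omega>. ennreal (W c0 c1 n \<omega> powr s) \<partial>M)"
      by (rule ennreal_suminf_cmult)
    also have "\<dots> < \<infinity>"
      using summable_moments[OF c s(1) pressure] by (simp add: ennreal_mult_less_top)
    finally show "(\<Sum>n. \<integral>\<^sup>+ \<omega>. emeasure (N K) {\<tau> \<in> space (N K). \<forall>k<n. Y \<omega> k = Y \<tau> k} * ennreal (1 / wt c0 c1 (Y \<omega>) n) \<partial>N K) < \<infinity>" .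
  qed
  then have "AE \<beta> in lborel. \<forall>K. \<beta> \<in> {c0<..<0.739} \<times> {c1<..<0.739} \<longrightarrow>
      (\<exists>C\<ge>0. bounded_energy (distr (N K) borel (\<lambda>\<omega>. code_sum (fst \<beta>) (snd \<beta>) (Y \<omega>))) C)"
    by (subst AE_all_countable) auto
  then show ?thesis
  proof eventually_elim
    fix \<beta> :: "real \<times> real"
    assume *: "\<forall>K. \<beta> \<in> {c0<..<0.739} \<times> {c1<..<0.739} \<longrightarrow>
      (\<exists>C\<ge>0. bounded_energy (distr (N K) borel (\<lambda>\<omega>. code_sum (fst \<beta>) (snd \<beta>) (Y \<omega>))) C)"
    let ?S = "\<lambda>\<omega>. code_sum (fst \<beta>) (snd \<beta>) (Y \<omega>)"
    have Sm [measurable]: "?S \<in> borel_measurable M" by measurable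
    then have SmN: "?S \<in> borel_measurable (N K)" for K
      by (simp add: measurable_cong_sets[OF N_sets refl])
    show "\<beta> \<in> {c0<..<0.739} \<times> {c1<..<0.739} \<longrightarrow>
        absolutely_continuous lborel (markov_geometric_measure (fst \<beta>) (snd \<beta>) M X)"
    proof
      assume \<beta>: "\<beta> \<in> {c0<..<0.739} \<times> {c1<..<0.739}"
      have ac: "absolutely_continuous lborel (distr (N K) borel ?S)" for K
      proof -
        obtain C where "0 \<le> C" "bounded_energy (distr (N K) borel ?S) C"
          using * \<beta> by blast
        then show ?thesis
          by (intro absolutely_continuous_of_energy finite_measure.finite_measure_distr[OF N_finite] SmN) auto
      qed
      show "absolutely_continuous lborel (markov_geometric_measure (fst \<beta>) (snd \<beta>) M X)"
        unfolding absolutely_continuous_def markov_geometric_measure_eq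
      proof
        fix A assume A: "A \<in> null_sets (lborel :: real measure)"
        then have A_sets: "A \<in> sets borel" by auto
        have pre: "?S -` A \<inter> space M \<in> sets M" using A_sets by (rule measurable_sets[OF Sm])
        have "AE \<omega> in M. \<omega> \<notin> tame c0 c1 K \<inter> (?S -` A \<inter> space M)" for K
        proof (rule AE_not_in)
          have "A \<in> null_sets (distr (N K) borel ?S)"
            using ac[of K] A by (auto simp: absolutely_continuous_def)
          then have "emeasure (distr (N K) borel ?S) A = 0" by auto
          then have "emeasure (N K) (?S -` A \<inter> space M) = 0"
            using emeasure_distr[OF SmN A_sets, of K] by simp
          then show "tame c0 c1 K \<inter> (?S -` A \<inter> space M) \<in> null_sets M"
            using pre by (auto simp: N_emeasure null_sets_def)
        qed
        then have "AE \<omega> in M. \<forall>K. \<omega> \<notin> tame c0 c1 K \<inter> (?S -` A \<inter> space M)"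
          by (subst AE_all_countable) auto
        then have "AE \<omega> in M. \<omega> \<notin> ?S -` A \<inter> space M"
          using AE_tame[OF c s(1) pressure] by eventually_elim blast
        then have "?S -` A \<inter> space M \<in> null_sets M"
          using pre by (simp add: AE_iff_null_sets)
        then show "A \<in> null_sets (distr M borel ?S)"
          using A_sets Sm by (simp add: null_sets_def emeasure_distr)
      qed
    qed
  qed
qed

end

section \<open>The two parameter regions\<close>

text \<open>Since the pressure sum is continuous, the regions are covered by countably many boxes with rational
lower corners. Explicitly: shrinking both parameters by factors between some \<open>t < 1\<close> and 1 raises the pressure
sum at most by the factor \<open>1 / t\<^sup>2\<close>, as \<open>s \<le> 1\<close>.\<close>
lemma pressure_sum_below:
  assumes p: "0 < p" "p < 1" and b: "0 < b0" "0 < b1" and s: "0 < s" "s \<le> 1"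
    and pressure: "pressure_sum p s b0 b1 < 1"
  obtains c0 c1 where "c0 \<in> \<rat>" "c1 \<in> \<rat>" "0 < c0" "c0 < b0" "0 < c1" "c1 < b1"
    "pressure_sum p s c0 c1 < 1"
proof -
  let ?P = "pressure_sum p s b0 b1"
  define t where "t = sqrt ((?P + 1) / 2)"
  have P: "0 \<le> ?P" using p by (simp add: pressure_sum_def)
  have t2: "t\<^sup>2 = (?P + 1) / 2" using P by (simp add: t_def)
  have t: "0 < t" "t < 1" using P pressure by (auto simp: t_def real_less_lsqrt)
  obtain c0 where c0: "c0 \<in> \<rat>" "t * b0 < c0" "c0 < b0"
    using Rats_dense_in_real[of "t * b0" b0] t b by auto
  obtain c1 where c1: "c1 \<in> \<rat>" "t * b1 < c1" "c1 < b1"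
    using Rats_dense_in_real[of "t * b1" b1] t b by auto
  have pos: "0 < c0" "0 < c1"
    using c0 c1 t b by (meson less_trans mult_pos_pos)+
  have le: "(x / y) powr s \<le> (x / z) powr s / t\<^sup>2" if x: "0 < x" and z: "0 < z" and y: "t\<^sup>2 * z \<le> y" for x y z
  proof -
    have yp: "0 < t\<^sup>2 * z" using t z by simp
    have "t\<^sup>2 = (t\<^sup>2) powr 1" using t by simp
    also have "\<dots> \<le> (t\<^sup>2) powr s"
      using t s by (intro powr_mono') (auto simp: power_le_one)
    finally have ts: "t\<^sup>2 \<le> (t\<^sup>2) powr s" .
    have "x / y \<le> x / (t\<^sup>2 * z)"
      using x y yp z by (intro divide_left_mono mult_pos_pos) auto
    also have "\<dots> = x / z / t\<^sup>2" by (simp add: mult.commute)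
    finally have "(x / y) powr s \<le> (x / z / t\<^sup>2) powr s"
      using x y yp s by (intro powr_mono2) auto
    also have "\<dots> = (x / z) powr s / (t\<^sup>2) powr s"
      by (rule powr_divide)
    also have "\<dots> \<le> (x / z) powr s / t\<^sup>2"
      using ts t by (intro divide_left_mono) auto
    finally show ?thesis .
  qed
  have "t\<^sup>2 * b0 \<le> t * b0"
    using t b mult_left_le[of t t] by (intro mult_right_mono) (simp_all add: power2_eq_square)
  then have "t\<^sup>2 * b0 \<le> c0" using c0 by simp
  moreover have "t\<^sup>2 * (b0 * b1) \<le> c0 * c1"
    using mult_mono[of "t * b0" c0 "t * b1" c1] c0 c1 pos t b by (simp add: power2_eq_square ac_simps)
  ultimately have "pressure_sum p s c0 c1 \<le> p * ((p / b0) powr s / t\<^sup>2) + (1 - p) * (((1 - p) / (b0 * b1)) powr s / t\<^sup>2)"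
    unfolding pressure_sum_def using p b by (intro add_mono mult_left_mono le) auto
  also have "\<dots> = ?P / t\<^sup>2" by (simp add: pressure_sum_def add_divide_distrib)
  also have "\<dots> < 1" using P pressure by (simp add: t2 divide_less_eq)
  finally show thesis using that c0 c1 pos by blast
qed

text \<open>The pressure sum is 1 at \<open>s = 0\<close>, and its derivative there is
\<open>p ln p + (1 - p) ln (1 - p) - ln (b0 b1\<^bsup>1-p\<^esup>)\<close>, negative precisely under the entropy condition.\<close>
lemma pressure_sum_less_1_of_entropy:
  assumes p: "0 < p" "p < 1" and b: "0 < b0" "0 < b1"
    and entropy: "p powr p * (1 - p) powr (1 - p) < b0 * b1 powr (1 - p)"
  obtains s where "0 < s" "s \<le> 1" "pressure_sum p s b0 b1 < 1"
proof -
  define D where "D = p * ln (p / b0) + (1 - p) * ln ((1 - p) / (b0 * b1))"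
  have "ln (p powr p * (1 - p) powr (1 - p)) < ln (b0 * b1 powr (1 - p))"
    using entropy p b by (subst ln_less_cancel_iff) auto
  then have "D < 0"
    using p b by (simp add: D_def ln_mult ln_div ln_powr algebra_simps)
  have "((\<lambda>s. pressure_sum p s b0 b1) has_real_derivative D) (at 0)"
    unfolding pressure_sum_def D_def using p b
    by (auto intro!: derivative_eq_intros simp: powr_def)
  from DERIV_neg_dec_right[OF this \<open>D < 0\<close>]
  obtain d where d: "0 < d" "\<And>h. 0 < h \<Longrightarrow> h < d \<Longrightarrow> pressure_sum p (0 + h) b0 b1 < pressure_sum p 0 b0 b1"
    by auto
  have "pressure_sum p 0 b0 b1 = 1" using p b by (simp add: pressure_sum_def)
  with d(2)[of "min (d / 2) 1"] d(1) have "pressure_sum p (min (d / 2) 1) b0 b1 < 1"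
    by (simp add: min_less_iff_disj)
  then show thesis using that[of "min (d / 2) 1"] d(1) by simp
qed

text \<open>At \<open>s = 1\<close> the pressure sum is \<open>p\<^sup>2 / b0 + (1 - p)\<^sup>2 / (b0 b1)\<close>.\<close>
lemma pressure_sum_1_less_1:
  assumes p: "0 < p" "p < 1" and b: "0 < b0" "0 < b1"
    and spectral: "(1 - p)\<^sup>2 < (b0 - p\<^sup>2) * b1"
  shows "pressure_sum p 1 b0 b1 < 1"
proof -
  have "pressure_sum p 1 b0 b1 = (p\<^sup>2 * b1 + (1 - p)\<^sup>2) / (b0 * b1)"
    using p b by (simp add: pressure_sum_def field_simps power2_eq_square)
  also have "\<dots> < 1" using spectral b by (simp add: divide_less_eq algebra_simps)
  finally show ?thesis .
qed

theorem theorem3p2: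
  fixes p :: real and M :: "'a measure" and X :: "nat \<Rightarrow> 'a \<Rightarrow> nat"
  assumes "0 < p" and "p < 1"
    and "markov_chain01 p M X"
  shows "(AE (\<beta>0, \<beta>1) in (lborel :: (real \<times> real) measure).
            \<beta>0 \<in> {0<..<0.739} \<and> \<beta>1 \<in> {0<..<0.739} \<and>
            \<beta>0 * \<beta>1 powr (1 - p) > p powr p * (1 - p) powr (1 - p) \<longrightarrow>
            absolutely_continuous lborel (markov_geometric_measure \<beta>0 \<beta>1 M X))
       \<and> (AE (\<beta>0, \<beta>1) in (lborel :: (real \<times> real) measure).
            \<beta>0 \<in> {0<..<0.739} \<and> \<beta>1 \<in> {0<..<0.739} \<and>
            (\<beta>0 - p\<^sup>2) * \<beta>1 > (1 - p)\<^sup>2 \<longrightarrow>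
            has_L2_density (markov_geometric_measure \<beta>0 \<beta>1 M X))"
proof -
  interpret prob_space M using assms(3) by (simp add: markov_chain01_def)
  interpret hard_core_chain M p X by unfold_locales (use assms in auto)
  have countable: "countable (\<rat> \<times> \<rat> :: (real \<times> real) set)"
    by (intro countable_SIGMA countable_rat)
  let ?box = "\<lambda>c. {fst c<..<0.739} \<times> {snd c<..<0.739 :: real}"
  have "AE \<beta> in lborel. \<forall>c\<in>\<rat> \<times> \<rat>. 0 < fst c \<and> fst c < 1 \<and> 0 < snd c \<and> snd c < 1 \<and>
      (\<exists>s. 0 < s \<and> s \<le> 1 \<and> pressure_sum p s (fst c) (snd c) < 1) \<longrightarrow> \<beta> \<in> ?box c \<longrightarrow>
      absolutely_continuous lborel (markov_geometric_measure (fst \<beta>) (snd \<beta>) M X)"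
  proof (rule AE_ball_countable[THEN iffD2, OF countable], rule ballI)
    fix c :: "real \<times> real"
    show "AE \<beta> in lborel. 0 < fst c \<and> fst c < 1 \<and> 0 < snd c \<and> snd c < 1 \<and>
      (\<exists>s. 0 < s \<and> s \<le> 1 \<and> pressure_sum p s (fst c) (snd c) < 1) \<longrightarrow> \<beta> \<in> ?box c \<longrightarrow>
      absolutely_continuous lborel (markov_geometric_measure (fst \<beta>) (snd \<beta>) M X)"
      using AE_box_absolutely_continuous[of "fst c" "snd c"]
      by (cases "0 < fst c \<and> fst c < 1 \<and> 0 < snd c \<and> snd c < 1 \<and>
        (\<exists>s. 0 < s \<and> s \<le> 1 \<and> pressure_sum p s (fst c) (snd c) < 1)") auto
  qed
  then have "AE (\<beta>0, \<beta>1) in (lborel :: (real \<times> real) measure).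
      \<beta>0 \<in> {0<..<0.739} \<and> \<beta>1 \<in> {0<..<0.739} \<and>
      \<beta>0 * \<beta>1 powr (1 - p) > p powr p * (1 - p) powr (1 - p) \<longrightarrow>
      absolutely_continuous lborel (markov_geometric_measure \<beta>0 \<beta>1 M X)"
  proof eventually_elim
    case (elim \<beta>)
    obtain b0 b1 where \<beta>: "\<beta> = (b0, b1)" by (cases \<beta>)
    show ?case
      unfolding \<beta> prod.case
    proof (intro impI, elim conjE)
      assume b: "b0 \<in> {0<..<0.739}" "b1 \<in> {0<..<0.739}"
        and "p powr p * (1 - p) powr (1 - p) < b0 * b1 powr (1 - p)"
      then obtain s where s: "0 < s" "s \<le> 1" "pressure_sum p s b0 b1 < 1"
        using pressure_sum_less_1_of_entropy[OF p, of b0 b1] by auto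
      then obtain c0 c1 where c: "c0 \<in> \<rat>" "c1 \<in> \<rat>" "0 < c0" "c0 < b0" "0 < c1" "c1 < b1"
          "pressure_sum p s c0 c1 < 1"
        using pressure_sum_below[OF p, of b0 b1 s] b by auto
      then show "absolutely_continuous lborel (markov_geometric_measure b0 b1 M X)"
        using elim[rule_format, of "(c0, c1)"] s b \<beta> by auto
    qed
  qed
  moreover have "AE \<beta> in lborel. \<forall>c\<in>\<rat> \<times> \<rat>. 0 < fst c \<and> fst c < 1 \<and> 0 < snd c \<and> snd c < 1 \<and>
      pressure_sum p 1 (fst c) (snd c) < 1 \<longrightarrow> \<beta> \<in> ?box c \<longrightarrow>
      has_L2_density (markov_geometric_measure (fst \<beta>) (snd \<beta>) M X)"
  proof (rule AE_ball_countable[THEN iffD2, OF countable], rule ballI)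
    fix c :: "real \<times> real"
    show "AE \<beta> in lborel. 0 < fst c \<and> fst c < 1 \<and> 0 < snd c \<and> snd c < 1 \<and>
      pressure_sum p 1 (fst c) (snd c) < 1 \<longrightarrow> \<beta> \<in> ?box c \<longrightarrow>
      has_L2_density (markov_geometric_measure (fst \<beta>) (snd \<beta>) M X)"
      using AE_box_L2_density[of "fst c" "snd c"]
      by (cases "0 < fst c \<and> fst c < 1 \<and> 0 < snd c \<and> snd c < 1 \<and> pressure_sum p 1 (fst c) (snd c) < 1") auto
  qed
  then have "AE (\<beta>0, \<beta>1) in (lborel :: (real \<times> real) measure).
      \<beta>0 \<in> {0<..<0.739} \<and> \<beta>1 \<in> {0<..<0.739} \<and>
      (\<beta>0 - p\<^sup>2) * \<beta>1 > (1 - p)\<^sup>2 \<longrightarrow>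
      has_L2_density (markov_geometric_measure \<beta>0 \<beta>1 M X)"
  proof eventually_elim
    case (elim \<beta>)
    obtain b0 b1 where \<beta>: "\<beta> = (b0, b1)" by (cases \<beta>)
    show ?case
      unfolding \<beta> prod.case
    proof (intro impI, elim conjE)
      assume b: "b0 \<in> {0<..<0.739}" "b1 \<in> {0<..<0.739}" and "(1 - p)\<^sup>2 < (b0 - p\<^sup>2) * b1"
      then have "pressure_sum p 1 b0 b1 < 1"
        using pressure_sum_1_less_1[OF p, of b0 b1] by auto
      then obtain c0 c1 where c: "c0 \<in> \<rat>" "c1 \<in> \<rat>" "0 < c0" "c0 < b0" "0 < c1" "c1 < b1"
          "pressure_sum p 1 c0 c1 < 1"
        using pressure_sum_below[OF p, of b0 b1 1] b by auto
      then show "has_L2_density (markov_geometric_measure b0 b1 M X)"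
        using elim[rule_format, of "(c0, c1)"] b \<beta> by auto
    qed
  qed
  ultimately show ?thesis by blast
qed

end
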